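(* Let $p$ be a fixed prime. For $n\geq 1$ let $P_n$ be a Sylow $p$-subgroup of the symmetric group $S_{p^n}$, and let $\xi_n=\log_p o(C)$, where $C$ is a conjugacy class of $P_n$ chosen uniformly at random among all conjugacy classes of $P_n$, and $o(C)$ is the common order of the elements of $C$. Then, as $n$ ranges over the positive integers, the mean value of $\xi_n$ is $$\mathbf{E}(\xi_n)=\frac{\log n}{\log p}+O(1),$$ and the variance of $\xi_n$ is bounded; that is, there is a constant $K$ depending only on $p$ such that $\left|\mathbf{E}(\xi_n)-\frac{\log n}{\log p}\right|\leq K$ and $\mathrm{Var}(\xi_n)\leq K$ for all $n\geq 1$.
   Context: Here $\log$ is the natural logarithm and $\log_p$ the logarithm to base $p$. All elements of a conjugacy class have the same order, so $o(C)$ is well defined; since $P_n$ is a $p$-group, $\xi_n$ takes non-negative integer values. Each conjugacy class of $P_n$ is chosen with equal probability (regardless of its size). *)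

theory Defs
  imports
    "HOL-Probability.Probability_Mass_Function"
    "HOL-Computational_Algebra.Factorial_Ring"
    "HOL-Algebra.Group_Action"
    "HOL-Algebra.Multiplicative_Group"
    "HOL-Algebra.Sylow"
    "HOL-Algebra.Sym_Groups"
begin

definition sylow_subgroup :: "nat \<Rightarrow> ('a, 'b) monoid_scheme \<Rightarrow> 'a set \<Rightarrow> bool" where
  "sylow_subgroup p G H \<longleftrightarrow> subgroup H G \<and> card H = p ^ multiplicity p (order G)"

text \<open>
  The orbits of the action of a group on itself by conjugation
  (see \<open>group.action_by_conjugation\<close>).
\<close>

definition conj_classes :: "('a, 'b) monoid_scheme \<Rightarrow> 'a set set" where
  "conj_classes G =
     orbits G (carrier G) (\<lambda>g. \<lambda>h\<in>carrier G. g \<otimes>\<^bsub>G\<^esub> h \<otimes>\<^bsub>G\<^esub> inv\<^bsub>G\<^esub> g)"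

definition class_ord :: "('a, 'b) monoid_scheme \<Rightarrow> 'a set \<Rightarrow> nat" where
  "class_ord G C = (THE k. \<forall>x\<in>C. group.ord G x = k)"

definition log_class_ord :: "nat \<Rightarrow> ('a, 'b) monoid_scheme \<Rightarrow> 'a set \<Rightarrow> real" where
  "log_class_ord p G C = log (real p) (real (class_ord G C))"

definition random_conj_class :: "('a, 'b) monoid_scheme \<Rightarrow> 'a set pmf" where
  "random_conj_class G = pmf_of_set (conj_classes G)"

text \<open>
  \<open>class_ord\<close> and \<open>random_conj_class\<close> are specified only where the order is constant on the
  class and the set of classes is finite and nonempty; the lemmas below give this for finite groups.
\<close>

lemma (in group) conj_classE:
  assumes "C \<in> conj_classes G"
  obtains h where "h \<in> carrier G" "C = {g \<otimes> h \<otimes> inv g | g. g \<in> carrier G}"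
  using assms by (auto simp: conj_classes_def orbits_def orbit_def)

lemma (in group) conj_pow:
  assumes "g \<in> carrier G" "h \<in> carrier G"
  shows "(g \<otimes> h \<otimes> inv g) [^] (n::nat) = g \<otimes> h [^] n \<otimes> inv g"
proof (induction n)
  case (Suc n)
  have "inv g \<otimes> (g \<otimes> (h \<otimes> inv g)) = h \<otimes> inv g"
    using assms by (simp add: m_assoc[symmetric])
  then show ?case using Suc assms by (simp add: m_assoc)
qed (use assms in simp)

lemma (in group) ord_conj:
  assumes "g \<in> carrier G" "h \<in> carrier G"
  shows "ord (g \<otimes> h \<otimes> inv g) = ord h"
proof -
  have "(g \<otimes> h \<otimes> inv g) [^] n = \<one> \<longleftrightarrow> h [^] n = \<one>" for n :: nat
  proof -
    have "g \<otimes> h [^] n \<otimes> inv g = \<one> \<longleftrightarrow> g \<otimes> h [^] n = g"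
      using assms inv_solve_right'[of \<one> "g \<otimes> h [^] n" g] by auto
    also have "\<dots> \<longleftrightarrow> h [^] n = \<one>"
      using assms by simp
    finally show ?thesis using conj_pow[OF assms] by simp
  qed
  then show ?thesis by (simp add: ord_def)
qed

lemma (in group) class_ord_eq:
  assumes "C \<in> conj_classes G" "x \<in> C"
  shows "class_ord G C = ord x"
proof -
  from assms(1) obtain h where h: "h \<in> carrier G"
    "C = {g \<otimes> h \<otimes> inv g | g. g \<in> carrier G}" by (rule conj_classE)
  have "\<forall>y\<in>C. ord y = ord x" using h assms(2) ord_conj by auto
  then show ?thesis unfolding class_ord_def using assms(2) by (intro the_equality) metis+
qed

lemma (in group) conj_classes_nonempty: "conj_classes G \<noteq> {}"
  unfolding conj_classes_def orbits_def by blast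

lemma finite_conj_classes: "finite (carrier G) \<Longrightarrow> finite (conj_classes G)"
  unfolding conj_classes_def orbits_def by simp

lemma (in group) sylow_subgroup_exists:
  assumes "prime p" "finite (carrier G)"
  shows "\<exists>H. sylow_subgroup p G H"
proof -
  obtain m where "order G = p ^ multiplicity p (order G) * m"
    using multiplicity_dvd by (metis dvdE)
  from sylow_thm[OF assms(1) is_group this assms(2)] show ?thesis
    unfolding sylow_subgroup_def .
qed

end

theory Submission
  imports Defs "HOL-Number_Theory.Cong"
begin

text \<open>
  A Sylow subgroup \<open>P\<^sub>n\<close> of the symmetric group on \<open>p\<^sup>n\<close> points is the \<open>n\<close>-fold iterated wreath
  product of the cyclic group of order \<open>p\<close>: \<open>P\<^bsub>n+1\<^esub>\<close> is the wreath product of \<open>P\<^sub>n\<close> with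
  that group. Let \<open>a\<^sub>n(i)\<close> be the number of classes of \<open>P\<^sub>n\<close> whose order divides \<open>p\<^sup>i\<close>, and
  \<open>K\<^sub>n\<close> the number of all classes. The wreath structure gives
  \<open>a\<^bsub>n+1\<^esub>(i) = (a\<^sub>n(i)\<^sup>p + (p - 1) a\<^sub>n(i)) / p + (p - 1) a\<^sub>n(i - 1)\<close> with \<open>a\<^sub>0(i) = 1\<close>
  (\<open>comm_count_wreath\<close>, \<open>sylow_wreath_step\<close>). The first summand counts the classes of the base group,
  where the order is the largest of the orders of the coordinates; the second counts the classes outside it,
  where taking the \<open>p\<close>-th power lands on a conjugate of a constant tuple. Since all Sylow subgroups
  are conjugate, \<open>a\<^sub>n(i) / K\<^sub>n\<close> is the distribution function of \<open>\<xi>\<^sub>n\<close>.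

  To obtain the recurrence without handling orbits of tuples, classes are counted by commuting pairs:
  the number of pairs \<open>(x, y)\<close> with \<open>xy = yx\<close> and \<open>x\<^sup>k = 1\<close> is \<open>|G|\<close> times the number of classes of
  order dividing \<open>k\<close> (\<open>comm_count_eq_card_classes\<close>).

  The recurrence makes \<open>K\<^sub>n\<close> doubly exponential: \<open>log K\<^sub>n\<close> is of order \<open>p\<^sup>n\<close>.
  Let \<open>p\<^sup>m \<le> n < p\<^bsup>m+1\<^esup>\<close>; both tails of \<open>\<xi>\<^sub>n\<close> are tiny once one leaves
  a bounded neighbourhood of \<open>m\<close>.

  \<^item> Upper tail. The proportion of classes of order exceeding \<open>p\<^sup>i\<close> vanishes as long as \<open>n \<le> i\<close>, and one
    step multiplies it by at most \<open>p\<close> up to an additive \<open>p\<^sup>2 / K\<^sub>n\<close>. So it is at most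
    \<open>p\<^bsup>n+2\<^esup> / K\<^sub>i\<close> (\<open>upper_tail\<close>), and for \<open>i = m + 5\<close> the denominator is at least \<open>p\<^bsup>2n\<^esup>\<close>.

  \<^item> Lower tail. The excess \<open>K\<^sub>n / a\<^sub>n(i) - 1\<close> becomes positive at \<open>n = i + 1\<close>, where it is at least
    \<open>1 / K\<^bsub>i+1\<^esub>\<close>, and every later step multiplies it by at least \<open>1 + 1 / p\<^sup>2\<close>
    (\<open>lower_tail_step\<close>). So \<open>a\<^sub>n(i) / K\<^sub>n\<close> is at most \<open>K\<^bsub>i+1\<^esub>\<close> divided by an exponential in
    \<open>n - i\<close>, and \<open>K\<^bsub>i+1\<^esub>\<close> is negligible against it when \<open>p\<^bsup>i+1\<^esup>\<close> is a small multiple of \<open>n\<close>.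

  Hence \<open>(\<xi>\<^sub>n - m)\<^sup>2\<close> has bounded expectation (\<open>second_moment_bounded\<close>), which bounds the variance and
  the distance of the mean from \<open>m\<close>, and so from \<open>log n / log p\<close>.
\<close>

section \<open>Counting classes by commuting pairs\<close>

text \<open>
  Divided by the group order, this is the number of classes whose order divides \<open>k\<close>; unlike that number it is
  computed coordinate by coordinate in a wreath product.
\<close>

definition comm_count :: "('a, 'b) monoid_scheme \<Rightarrow> nat \<Rightarrow> nat" where
  "comm_count G k = card {(x, y). x \<in> carrier G \<and> y \<in> carrier G \<and>
     x \<otimes>\<^bsub>G\<^esub> y = y \<otimes>\<^bsub>G\<^esub> x \<and> x [^]\<^bsub>G\<^esub> k = \<one>\<^bsub>G\<^esub>}"

text \<open>
  Double counting: the two forms let a count of commuting pairs be summed over either component.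
\<close>

lemma card_pairs_eq_sum:
  assumes "finite A" "finite B"
  shows "card {(x, y). x \<in> A \<and> y \<in> B \<and> R x y} = (\<Sum>x\<in>A. card {y\<in>B. R x y})"
    and "card {(x, y). x \<in> A \<and> y \<in> B \<and> R x y} = (\<Sum>y\<in>B. card {x\<in>A. R x y})"
proof -
  have "{(x, y). x \<in> A \<and> y \<in> B \<and> R x y} = Sigma A (\<lambda>x. {y\<in>B. R x y})" by auto
  then show 1: "card {(x, y). x \<in> A \<and> y \<in> B \<and> R x y} = (\<Sum>x\<in>A. card {y\<in>B. R x y})"
    using assms by (simp add: card_SigmaI)
  have "(\<Sum>x\<in>A. card {y\<in>B. R x y}) = (\<Sum>x\<in>A. \<Sum>y\<in>B. if R x y then 1 else 0)"
    using assms by (simp add: sum.If_cases Int_def)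
  also have "\<dots> = (\<Sum>y\<in>B. \<Sum>x\<in>A. if R x y then 1 else 0)" by (rule sum.swap)
  also have "\<dots> = (\<Sum>y\<in>B. card {x\<in>A. R x y})" using assms by (simp add: sum.If_cases Int_def)
  finally show "card {(x, y). x \<in> A \<and> y \<in> B \<and> R x y} = (\<Sum>y\<in>B. card {x\<in>A. R x y})"
    using 1 by simp
qed

text \<open>
  Orbit counting for conjugation: for fixed \<open>x\<close> the commuting \<open>y\<close> form the stabilizer of \<open>x\<close>, and the
  stabilizers along one class have total size \<open>|G|\<close>. The condition \<open>x\<^sup>k = 1\<close> selects whole classes.
\<close>

lemma (in group) comm_count_eq_card_classes:
  assumes fin: "finite (carrier G)"
  shows "comm_count G k = order G * card {C \<in> conj_classes G. class_ord G C dvd k}"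
proof -
  define \<phi> where "\<phi> = (\<lambda>g. \<lambda>h\<in>carrier G. g \<otimes> h \<otimes> inv g)"
  interpret conj: group_action G "carrier G" \<phi>
    unfolding \<phi>_def by (rule action_by_conjugation)
  have classes: "conj_classes G = orbits G (carrier G) \<phi>"
    unfolding conj_classes_def \<phi>_def ..
  have stab: "stabilizer G \<phi> x = {y \<in> carrier G. x \<otimes> y = y \<otimes> x}" if "x \<in> carrier G" for x
    unfolding stabilizer_def \<phi>_def using that inv_solve_right' by auto
  define f where "f x = (if x [^] k = \<one> then card (stabilizer G \<phi> x) else 0)" for x
  have "comm_count G k = (\<Sum>x\<in>carrier G. card {y \<in> carrier G. x \<otimes> y = y \<otimes> x \<and> x [^] k = \<one>})"
    unfolding comm_count_def by (rule card_pairs_eq_sum(1)[OF fin fin])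
  also have "\<dots> = (\<Sum>x\<in>carrier G. f x)"
    unfolding f_def by (intro sum.cong) (auto simp: stab)
  also have "\<dots> = (\<Sum>C\<in>conj_classes G. \<Sum>x\<in>C. f x)"
    using conj.disjoint_sum[OF fin, of f] unfolding classes by simp
  also have "\<dots> = (\<Sum>C\<in>conj_classes G. if class_ord G C dvd k then order G else 0)"
  proof (intro sum.cong refl)
    fix C assume C: "C \<in> conj_classes G"
    have "C \<subseteq> carrier G" using C conj.orbits_coverture unfolding classes by blast
    then have "f x = (if class_ord G C dvd k then card (stabilizer G \<phi> x) else 0)" if "x \<in> C" for x
      using that class_ord_eq[OF C that] pow_eq_id[of x k] unfolding f_def by auto
    then have "(\<Sum>x\<in>C. f x) = (\<Sum>x\<in>C. if class_ord G C dvd k then card (stabilizer G \<phi> x) else 0)"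
      by (intro sum.cong) auto
    also have "\<dots> = (if class_ord G C dvd k then order G else 0)"
      using conj.card_stablizer_sum[OF fin, of C] C unfolding classes by simp
    finally show "(\<Sum>x\<in>C. f x) = (if class_ord G C dvd k then order G else 0)" .
  qed
  also have "\<dots> = order G * card {C \<in> conj_classes G. class_ord G C dvd k}"
    using finite_conj_classes[OF fin] by (simp add: sum.If_cases Int_def)
  finally show ?thesis .
qed

lemma comm_count_iso:
  assumes G: "group G" and H: "group H" and \<phi>: "\<phi> \<in> iso G H"
  shows "comm_count G k = comm_count H k"
proof -
  interpret group_hom G H \<phi>
    using assms by (simp add: group_hom_def group_hom_axioms_def iso_def)
  have bij: "bij_betw \<phi> (carrier G) (carrier H)" using \<phi> by (simp add: iso_def)
  have inj: "\<phi> x = \<phi> y \<longleftrightarrow> x = y" if "x \<in> carrier G" "y \<in> carrier G" for x y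
    using bij that by (metis bij_betw_def inj_on_eq_iff)
  have pow: "\<phi> x [^]\<^bsub>H\<^esub> k = \<one>\<^bsub>H\<^esub> \<longleftrightarrow> x [^]\<^bsub>G\<^esub> k = \<one>\<^bsub>G\<^esub>" if "x \<in> carrier G" for x
    using that inj[of "x [^]\<^bsub>G\<^esub> k" "\<one>\<^bsub>G\<^esub>"] by (simp add: hom_nat_pow)
  have comm: "\<phi> x \<otimes>\<^bsub>H\<^esub> \<phi> y = \<phi> y \<otimes>\<^bsub>H\<^esub> \<phi> x \<longleftrightarrow> x \<otimes>\<^bsub>G\<^esub> y = y \<otimes>\<^bsub>G\<^esub> x"
    if "x \<in> carrier G" "y \<in> carrier G" for x y
    using that inj[of "x \<otimes>\<^bsub>G\<^esub> y" "y \<otimes>\<^bsub>G\<^esub> x"] by simp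
  have img: "\<phi> ` carrier G = carrier H" using bij by (simp add: bij_betw_def)
  have "bij_betw (map_prod \<phi> \<phi>)
      {(x, y). x \<in> carrier G \<and> y \<in> carrier G \<and> x \<otimes>\<^bsub>G\<^esub> y = y \<otimes>\<^bsub>G\<^esub> x \<and> x [^]\<^bsub>G\<^esub> k = \<one>\<^bsub>G\<^esub>}
      {(x, y). x \<in> carrier H \<and> y \<in> carrier H \<and> x \<otimes>\<^bsub>H\<^esub> y = y \<otimes>\<^bsub>H\<^esub> x \<and> x [^]\<^bsub>H\<^esub> k = \<one>\<^bsub>H\<^esub>}"
  proof (rule bij_betwI', goal_cases)
    case (1 a b)
    then show ?case using inj by auto
  next
    case (2 b)
    then show ?case using comm pow by auto
  next
    case (3 b)
    obtain x y where b: "b = (x, y)" by (cases b)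
    from 3 have xyH: "x \<in> carrier H" "y \<in> carrier H"
      and rel: "x \<otimes>\<^bsub>H\<^esub> y = y \<otimes>\<^bsub>H\<^esub> x" "x [^]\<^bsub>H\<^esub> k = \<one>\<^bsub>H\<^esub>"
      unfolding b mem_Collect_eq case_prod_conv by blast+
    obtain x' y' where xy: "x' \<in> carrier G" "\<phi> x' = x" "y' \<in> carrier G" "\<phi> y' = y"
      using xyH unfolding img[symmetric] by blast
    then have "x' \<otimes>\<^bsub>G\<^esub> y' = y' \<otimes>\<^bsub>G\<^esub> x'" "x' [^]\<^bsub>G\<^esub> k = \<one>\<^bsub>G\<^esub>"
      using rel comm[of x' y'] pow[of x'] by simp_all
    with xy b show ?case by (intro bexI[of _ "(x', y')"]) simp_all
  qed
  then show ?thesis unfolding comm_count_def by (rule bij_betw_same_card)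
qed

text \<open>
  With \<open>s\<close> inverse to \<open>t\<close> modulo the group order, \<open>x\<^bsup>ts\<^esup> = x\<close> by Lagrange. So \<open>x\<close> and \<open>x\<^sup>t\<close> are
  powers of each other and have the same centralizer and the same order; in the wreath product this lets one replace
  any nontrivial top component by a generator of choice.
\<close>

lemma (in group) power_coprime_invertible:
  assumes fin: "finite (carrier G)" and cop: "coprime t (order G)"
  shows "\<exists>s. (\<forall>x\<in>carrier G. (x [^] t) [^] s = x \<and> (x [^] s) [^] t = x)
    \<and> t * s mod order G = 1 mod order G"
proof -
  obtain s where "[t * s = 1] (mod order G)" using cong_solve_coprime_nat[OF cop] by auto
  then have s: "t * s mod order G = 1 mod order G" by (simp add: cong_def)
  have "x [^] (t * s) = x" if x: "x \<in> carrier G" for x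
  proof -
    have "t * s mod ord x = 1 mod ord x"
      using s ord_dvd_group_order[OF x] by (metis mod_mod_cancel)
    then have "int (ord x) dvd int (t * s) - int 1"
      by (metis mod_eq_dvd_iff of_nat_mod)
    then have "x [^] (1::nat) = x [^] (t * s)"
      using int_pow_eq[OF x, of "int 1" "int (t * s)"] by (simp only: int_pow_int)
    then show ?thesis using x by simp
  qed
  then show ?thesis using s by (intro exI[of _ s]) (simp add: nat_pow_pow mult.commute)
qed

lemma (in group) comm_pow:
  assumes "x \<in> carrier G" "y \<in> carrier G" "x \<otimes> y = y \<otimes> x"
  shows "x \<otimes> y [^] (n::nat) = y [^] n \<otimes> x"
proof (induction n)
  case (Suc n)
  have "x \<otimes> y [^] Suc n = (x \<otimes> y [^] n) \<otimes> y" using assms by (simp add: m_assoc)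
  also have "\<dots> = y [^] n \<otimes> (x \<otimes> y)" using assms Suc by (simp add: m_assoc)
  also have "\<dots> = y [^] Suc n \<otimes> x" using assms by (simp add: m_assoc)
  finally show ?case .
qed (use assms in simp)


lemma (in group) conj_commute_iff:
  assumes "g \<in> carrier G" "x \<in> carrier G" "y \<in> carrier G"
  shows "(g \<otimes> x \<otimes> inv g) \<otimes> (g \<otimes> y \<otimes> inv g) = (g \<otimes> y \<otimes> inv g) \<otimes> (g \<otimes> x \<otimes> inv g)
    \<longleftrightarrow> x \<otimes> y = y \<otimes> x"
proof -
  have m: "(g \<otimes> a \<otimes> inv g) \<otimes> (g \<otimes> b \<otimes> inv g) = g \<otimes> (a \<otimes> b) \<otimes> inv g"
    if "a \<in> carrier G" "b \<in> carrier G" for a b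
  proof -
    have "inv g \<otimes> (g \<otimes> (b \<otimes> inv g)) = b \<otimes> inv g"
      using assms(1) that by (simp add: m_assoc[symmetric])
    then show ?thesis using assms(1) that by (simp add: m_assoc)
  qed
  show ?thesis unfolding m[OF assms(2,3)] m[OF assms(3,2)] using assms by simp
qed

lemma (in group) conj_cancel:
  assumes "g \<in> carrier G" "x \<in> carrier G"
  shows "inv g \<otimes> (g \<otimes> x \<otimes> inv g) \<otimes> g = x" "g \<otimes> (inv g \<otimes> x \<otimes> g) \<otimes> inv g = x"
proof -
  have "inv g \<otimes> (g \<otimes> (x \<otimes> (inv g \<otimes> g))) = x" "g \<otimes> (inv g \<otimes> (x \<otimes> (g \<otimes> inv g))) = x"
    using assms m_assoc[of "inv g" g x] m_assoc[of g "inv g" x] by auto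
  then show "inv g \<otimes> (g \<otimes> x \<otimes> inv g) \<otimes> g = x" "g \<otimes> (inv g \<otimes> x \<otimes> g) \<otimes> inv g = x"
    using assms by (simp_all add: m_assoc)
qed

lemma (in group) card_commuting_conj:
  assumes g: "g \<in> carrier G" and y: "y \<in> carrier G" and S: "S \<subseteq> carrier G"
    and closed: "\<And>x. x \<in> S \<Longrightarrow> g \<otimes> x \<otimes> inv g \<in> S" "\<And>x. x \<in> S \<Longrightarrow> inv g \<otimes> x \<otimes> g \<in> S"
  shows "card {x\<in>S. x \<otimes> (g \<otimes> y \<otimes> inv g) = (g \<otimes> y \<otimes> inv g) \<otimes> x \<and> x [^] (k::nat) = \<one>}
    = card {x\<in>S. x \<otimes> y = y \<otimes> x \<and> x [^] k = \<one>}"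
proof -
  define c where "c x = g \<otimes> x \<otimes> inv g" for x
  define d where "d x = inv g \<otimes> x \<otimes> g" for x
  have cS: "c x \<in> S" and dS: "d x \<in> S" if "x \<in> S" for x using closed that unfolding c_def d_def by auto
  have cd: "c (d x) = x" and dc: "d (c x) = x" if "x \<in> S" for x
    using conj_cancel[OF g, of x] that S unfolding c_def d_def by auto
  have rel: "c x \<otimes> c y = c y \<otimes> c x \<longleftrightarrow> x \<otimes> y = y \<otimes> x" if "x \<in> S" for x
    using conj_commute_iff[OF g _ y, of x] that S unfolding c_def by blast
  have pow: "c x [^] k = \<one> \<longleftrightarrow> x [^] k = \<one>" if "x \<in> S" for x
  proof -
    have x: "x \<in> carrier G" "c x \<in> carrier G" using that S g unfolding c_def by auto
    then show ?thesis using pow_eq_id[of x k] pow_eq_id[of "c x" k] ord_conj[OF g, of x] unfolding c_def by simp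
  qed
  have "bij_betw c {x\<in>S. x \<otimes> y = y \<otimes> x \<and> x [^] k = \<one>} {x\<in>S. x \<otimes> c y = c y \<otimes> x \<and> x [^] k = \<one>}"
  proof (rule bij_betw_byWitness[where f' = d])
    show "c ` {x\<in>S. x \<otimes> y = y \<otimes> x \<and> x [^] k = \<one>} \<subseteq> {x\<in>S. x \<otimes> c y = c y \<otimes> x \<and> x [^] k = \<one>}"
      using cS rel pow by blast
    show "d ` {x\<in>S. x \<otimes> c y = c y \<otimes> x \<and> x [^] k = \<one>} \<subseteq> {x\<in>S. x \<otimes> y = y \<otimes> x \<and> x [^] k = \<one>}"
    proof
      fix z assume "z \<in> d ` {x\<in>S. x \<otimes> c y = c y \<otimes> x \<and> x [^] k = \<one>}"
      then obtain x where x: "z = d x" "x \<in> S" "x \<otimes> c y = c y \<otimes> x" "x [^] k = \<one>" by blast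
      then show "z \<in> {x\<in>S. x \<otimes> y = y \<otimes> x \<and> x [^] k = \<one>}"
        using dS[of x] rel[of "d x"] pow[of "d x"] cd[of x] by simp
    qed
  qed (use cd dc in auto)
  then show ?thesis unfolding c_def by (rule bij_betw_same_card[symmetric])
qed


section \<open>The wreath product with a cyclic group\<close>

text \<open>
  An element \<open>(k, g)\<close> acts on \<open>p\<close> blocks: it applies \<open>g i\<close> inside block \<open>i\<close> and then moves block \<open>i\<close> to
  block \<open>i + k\<close> modulo \<open>p\<close>. The product composes these actions, the right factor acting first. Tuples are extensional functions, so
  that equality of elements is equality of coordinates.
\<close>

definition wreath :: "nat \<Rightarrow> ('a, 'b) monoid_scheme \<Rightarrow> (nat \<times> (nat \<Rightarrow> 'a)) monoid" where
  "wreath p G = \<lparr>carrier = {..<p} \<times> ({..<p} \<rightarrow>\<^sub>E carrier G),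
     mult = (\<lambda>(k, g) (l, h). ((k + l) mod p, \<lambda>i\<in>{..<p}. g ((i + l) mod p) \<otimes>\<^bsub>G\<^esub> h i)),
     one = (0, \<lambda>i\<in>{..<p}. \<one>\<^bsub>G\<^esub>)\<rparr>"

lemma carrier_wreath: "carrier (wreath p G) = {..<p} \<times> ({..<p} \<rightarrow>\<^sub>E carrier G)"
  and mult_wreath: "(k, g) \<otimes>\<^bsub>wreath p G\<^esub> (l, h)
    = ((k + l) mod p, \<lambda>i\<in>{..<p}. g ((i + l) mod p) \<otimes>\<^bsub>G\<^esub> h i)"
  and one_wreath: "\<one>\<^bsub>wreath p G\<^esub> = (0, \<lambda>i\<in>{..<p}. \<one>\<^bsub>G\<^esub>)"
  by (simp_all add: wreath_def)

lemma fst_mult_wreath: "fst (x \<otimes>\<^bsub>wreath p G\<^esub> y) = (fst x + fst y) mod p"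
  by (cases x; cases y) (simp add: mult_wreath)

lemma order_wreath: "order (wreath p G) = p * order G ^ p"
  by (simp add: order_def carrier_wreath card_cartesian_product card_PiE)

lemma finite_wreath: "finite (carrier G) \<Longrightarrow> finite (carrier (wreath p G))"
  by (simp add: carrier_wreath finite_PiE)

lemma (in group) group_wreath:
  assumes "p > 0"
  shows "group (wreath p G)"
proof (rule groupI)
  fix x y assume xy: "x \<in> carrier (wreath p G)" "y \<in> carrier (wreath p G)"
  obtain k f l g where e: "x = (k, f)" "y = (l, g)" by (metis surj_pair)
  have "f i \<in> carrier G" "g i \<in> carrier G" if "i < p" for i
    using xy that unfolding e carrier_wreath by auto
  then show "x \<otimes>\<^bsub>wreath p G\<^esub> y \<in> carrier (wreath p G)"
    using assms by (simp add: e carrier_wreath mult_wreath)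
next
  show "\<one>\<^bsub>wreath p G\<^esub> \<in> carrier (wreath p G)"
    using assms by (simp add: carrier_wreath one_wreath)
next
  fix x y z assume xyz: "x \<in> carrier (wreath p G)" "y \<in> carrier (wreath p G)" "z \<in> carrier (wreath p G)"
  obtain k f l g m h where e: "x = (k, f)" "y = (l, g)" "z = (m, h)" by (metis surj_pair)
  have c: "f i \<in> carrier G" "g i \<in> carrier G" "h i \<in> carrier G" if "i < p" for i
    using xyz that unfolding e carrier_wreath by auto
  have ml: "((i + m) mod p + l) mod p = (i + (l + m) mod p) mod p" for i
    by (metis add.assoc add.commute mod_add_left_eq mod_add_right_eq)
  have "((k + l) mod p + m) mod p = (k + (l + m) mod p) mod p"
    by (metis add.assoc mod_add_left_eq mod_add_right_eq)
  then show "x \<otimes>\<^bsub>wreath p G\<^esub> y \<otimes>\<^bsub>wreath p G\<^esub> z = x \<otimes>\<^bsub>wreath p G\<^esub> (y \<otimes>\<^bsub>wreath p G\<^esub> z)"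
    unfolding e mult_wreath prod.inject
  proof (intro conjI restrict_ext)
    fix i assume "i \<in> {..<p}"
    then show "(\<lambda>i\<in>{..<p}. f ((i + l) mod p) \<otimes> g i) ((i + m) mod p) \<otimes> h i
        = f ((i + (l + m) mod p) mod p) \<otimes> (\<lambda>i\<in>{..<p}. g ((i + m) mod p) \<otimes> h i) i"
      using c assms by (simp add: m_assoc ml)
  qed
next
  fix x assume x: "x \<in> carrier (wreath p G)"
  obtain l h where e: "x = (l, h)" by (metis surj_pair)
  have l: "l < p" and h: "h \<in> {..<p} \<rightarrow>\<^sub>E carrier G" using x e by (auto simp: carrier_wreath)
  then have hc: "h i \<in> carrier G" if "i < p" for i using that by auto
  have "(\<lambda>i\<in>{..<p}. (\<lambda>i\<in>{..<p}. \<one>) ((i + l) mod p) \<otimes> h i) = (\<lambda>i\<in>{..<p}. h i)"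
    using hc assms by (intro restrict_ext) simp
  also have "\<dots> = h" using h by (simp add: PiE_restrict)
  finally show "\<one>\<^bsub>wreath p G\<^esub> \<otimes>\<^bsub>wreath p G\<^esub> x = x"
    using l unfolding e one_wreath mult_wreath by simp
  define y where "y = ((p - l) mod p, \<lambda>i\<in>{..<p}. inv (h ((i + (p - l)) mod p)))"
  have "y \<in> carrier (wreath p G)" unfolding y_def using hc assms by (simp add: carrier_wreath)
  moreover have "y \<otimes>\<^bsub>wreath p G\<^esub> x = \<one>\<^bsub>wreath p G\<^esub>"
  proof -
    have "((i + l) mod p + (p - l)) mod p = i" if "i < p" for i
    proof -
      have "((i + l) mod p + (p - l)) mod p = (i + l + (p - l)) mod p" by (rule mod_add_left_eq)
      also have "i + l + (p - l) = i + p" using l by simp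
      finally show ?thesis using that by simp
    qed
    then have "(\<lambda>i\<in>{..<p}. (\<lambda>i\<in>{..<p}. inv (h ((i + (p - l)) mod p))) ((i + l) mod p) \<otimes> h i)
        = (\<lambda>i\<in>{..<p}. \<one>)"
      using hc assms by (intro restrict_ext) simp
    moreover have "((p - l) mod p + l) mod p = 0" using l by (simp add: mod_add_left_eq)
    ultimately show ?thesis unfolding y_def e one_wreath mult_wreath by simp
  qed
  ultimately show "\<exists>y\<in>carrier (wreath p G). y \<otimes>\<^bsub>wreath p G\<^esub> x = \<one>\<^bsub>wreath p G\<^esub>" by blast
qed

section \<open>Commuting pairs in the wreath product\<close>

lemma restrict_eq_iff: "(\<lambda>i\<in>A. f i) = (\<lambda>i\<in>A. g i) \<longleftrightarrow> (\<forall>i\<in>A. f i = g i)"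
  by (metis restrict_apply' restrict_ext)

text \<open>
  The orders of \<open>G\<close> and of the wreath product must be powers of \<open>p\<close> for \<open>x \<mapsto> x\<^sup>t\<close> to be
  invertible for every \<open>t\<close> prime to \<open>p\<close>.
\<close>

locale prime_wreath = group G for G (structure) +
  fixes p :: nat
  assumes prime: "prime p" and fin: "finite (carrier G)" and p_group: "\<exists>e. order G = p ^ e"
begin

abbreviation W where "W \<equiv> wreath p G"

lemma p_bounds: "0 < p" "1 < p" "p - Suc 0 < p"
  using prime_gt_1_nat[OF prime] by auto

sublocale W: group "wreath p G"
  using group_wreath[OF p_bounds(1)] .

lemma finite_W: "finite (carrier W)"
  using finite_wreath[OF fin] .

lemma W_p_group: "\<exists>e. order W = p ^ e"
proof -
  obtain e where "order G = p ^ e" using p_group ..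
  then have "order W = p ^ Suc (e * p)" by (simp add: order_wreath power_mult)
  then show ?thesis ..
qed

lemma fst_less: "x \<in> carrier W \<Longrightarrow> fst x < p"
  by (cases x) (simp add: carrier_wreath)

lemma fst_pow_W: "x \<in> carrier W \<Longrightarrow> fst (x [^]\<^bsub>W\<^esub> (n::nat)) = (n * fst x) mod p"
proof (induction n)
  case (Suc n)
  then have "fst (x [^]\<^bsub>W\<^esub> Suc n) = ((n * fst x) mod p + fst x) mod p" by (simp add: fst_mult_wreath)
  then show ?case by (simp add: mod_add_right_eq add.commute)
qed (simp add: one_wreath)

lemma fst_conj_W:
  assumes "g \<in> carrier W" "x \<in> carrier W"
  shows "fst (g \<otimes>\<^bsub>W\<^esub> x \<otimes>\<^bsub>W\<^esub> inv\<^bsub>W\<^esub> g) = fst x"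
proof -
  let ?z = "g \<otimes>\<^bsub>W\<^esub> x \<otimes>\<^bsub>W\<^esub> inv\<^bsub>W\<^esub> g"
  have "?z \<otimes>\<^bsub>W\<^esub> g = g \<otimes>\<^bsub>W\<^esub> x" using assms by (simp add: W.m_assoc)
  then have "(fst ?z + fst g) mod p = (fst g + fst x) mod p" by (metis fst_mult_wreath)
  then have "[fst ?z + fst g = fst x + fst g] (mod p)" by (simp add: cong_def add.commute)
  then have "[fst ?z = fst x] (mod p)" by (simp add: cong_add_rcancel_nat)
  then show ?thesis using fst_less[of ?z] fst_less[of x] assms by (simp add: cong_def)
qed

text \<open>
  Up to conjugation by the base group, these are all the elements with top component 1 (\<open>sum_top_one\<close>): every
  tuple over the generator of the top group can be moved into a single coordinate.
\<close>

definition twist :: "'a \<Rightarrow> nat \<times> (nat \<Rightarrow> 'a)" where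
  "twist c = (1, \<lambda>i\<in>{..<p}. if i = p - 1 then c else \<one>)"

lemma twist_closed: "c \<in> carrier G \<Longrightarrow> twist c \<in> carrier W"
  using p_bounds by (auto simp: twist_def carrier_wreath)

text \<open>
  Coordinate \<open>i\<close> of the equation identifies \<open>x\<close> at \<open>i + 1\<close> and at \<open>i\<close>, except at the last position,
  where both sides carry the factor \<open>c\<close>.
\<close>

lemma base_times_twist_commute_iff:
  assumes x: "x \<in> {..<p} \<rightarrow>\<^sub>E carrier G" and c: "c \<in> carrier G"
  shows "(0, x) \<otimes>\<^bsub>W\<^esub> twist c = twist c \<otimes>\<^bsub>W\<^esub> (0, x) \<longleftrightarrow>
    (\<forall>i<p. x i = x 0) \<and> x 0 \<otimes> c = c \<otimes> x 0" (is "?L \<longleftrightarrow> ?R")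
proof -
  have xc: "x i \<in> carrier G" if "i < p" for i using x that by auto
  have "?L \<longleftrightarrow> (\<forall>i\<in>{..<p}. x ((i + 1) mod p) \<otimes> (\<lambda>i\<in>{..<p}. if i = p - 1 then c else \<one>) i
      = (\<lambda>i\<in>{..<p}. if i = p - 1 then c else \<one>) ((i + 0) mod p) \<otimes> x i)"
    unfolding twist_def mult_wreath prod.inject restrict_eq_iff
    by (simp only: add_0_left add_0_right simp_thms)
  also have "\<dots> \<longleftrightarrow> (\<forall>i\<in>{..<p}. x (Suc i mod p) \<otimes> (if i = p - 1 then c else \<one>)
      = (if i = p - 1 then c else \<one>) \<otimes> x i)"
    by (intro ball_cong refl) simp
  also have "\<dots> \<longleftrightarrow> (\<forall>i<p. x (Suc i mod p) \<otimes> (if i = p - 1 then c else \<one>)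
      = (if i = p - 1 then c else \<one>) \<otimes> x i)"
    by (simp only: Ball_def lessThan_iff)
  also have "\<dots> \<longleftrightarrow> ?R"
  proof
    assume L: "\<forall>i<p. x (Suc i mod p) \<otimes> (if i = p - 1 then c else \<one>) = (if i = p - 1 then c else \<one>) \<otimes> x i"
    have const: "x i = x 0" if "i < p" for i
      using that
    proof (induction i)
      case (Suc i)
      then have i: "i < p" "i \<noteq> p - 1" by auto
      then have "x (Suc i mod p) \<otimes> \<one> = \<one> \<otimes> x i" using L by presburger
      then have "x (Suc i) = x i" using Suc.prems i xc by simp
      with Suc show ?case by simp
    qed simp
    have "x 0 \<otimes> c = c \<otimes> x (p - 1)" using L[rule_format, of "p - 1"] p_bounds by simp
    moreover have "x (p - 1) = x 0" using const[of "p - 1"] p_bounds(3) by simp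
    ultimately have "x 0 \<otimes> c = c \<otimes> x 0" by (simp only:)
    with const show ?R by blast
  next
    assume R: ?R
    have x0: "x 0 \<in> carrier G" using xc[OF p_bounds(1)] .
    show "\<forall>i<p. x (Suc i mod p) \<otimes> (if i = p - 1 then c else \<one>) = (if i = p - 1 then c else \<one>) \<otimes> x i"
    proof (intro allI impI)
      fix i assume i: "i < p"
      have "Suc i mod p < p" using p_bounds by simp
      then have "x (Suc i mod p) = x 0" "x i = x 0" using R i by blast+
      then show "x (Suc i mod p) \<otimes> (if i = p - 1 then c else \<one>) = (if i = p - 1 then c else \<one>) \<otimes> x i"
        using R[THEN conjunct2] x0 by (simp only: split: if_split) simp
    qed
  qed
  finally show ?thesis .
qed

lemma base_pow:
  assumes x: "x \<in> {..<p} \<rightarrow>\<^sub>E carrier G"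
  shows "(0, x) [^]\<^bsub>W\<^esub> (k::nat) = (0, \<lambda>i\<in>{..<p}. x i [^] k)"
proof (induction k)
  case (Suc k)
  have "(\<lambda>i\<in>{..<p}. (\<lambda>i\<in>{..<p}. x i [^] k) ((i + 0) mod p) \<otimes> x i) = (\<lambda>i\<in>{..<p}. x i [^] Suc k)"
    by (intro restrict_ext) simp
  then show ?case unfolding W.nat_pow_Suc Suc mult_wreath by (simp only: add_0_right mod_0)
qed (simp only: W.nat_pow_0 nat_pow_0 one_wreath)

lemma base_pow_eq_one:
  assumes x: "x \<in> {..<p} \<rightarrow>\<^sub>E carrier G"
  shows "(0, x) [^]\<^bsub>W\<^esub> (k::nat) = \<one>\<^bsub>W\<^esub> \<longleftrightarrow> (\<forall>i<p. x i [^] k = \<one>)"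
  unfolding base_pow[OF x] one_wreath prod.inject restrict_eq_iff
  by (simp only: Ball_def lessThan_iff simp_thms)

text \<open>
  After \<open>t\<close> steps the entry \<open>c\<close> has been met exactly by the blocks that passed the last position. At
  \<open>t = p\<close> every block has, so the \<open>p\<close>-th power is the constant tuple \<open>c\<close> in the base group.
\<close>

lemma twist_pow:
  assumes c: "c \<in> carrier G"
  shows "t \<le> p \<Longrightarrow> twist c [^]\<^bsub>W\<^esub> t = (t mod p, \<lambda>i\<in>{..<p}. if p \<le> i + t then c else \<one>)"
proof (induction t)
  case 0
  have "(\<lambda>i\<in>{..<p}. \<one>) = (\<lambda>i\<in>{..<p}. if p \<le> i + 0 then c else \<one>)" by (intro restrict_ext) simp
  then show ?case unfolding W.nat_pow_0 one_wreath by (simp only: mod_0)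
next
  case (Suc t)
  have "(\<lambda>i\<in>{..<p}. (\<lambda>i\<in>{..<p}. if p \<le> i + t then c else \<one>) ((i + 1) mod p)
        \<otimes> (\<lambda>i\<in>{..<p}. if i = p - 1 then c else \<one>) i)
      = (\<lambda>i\<in>{..<p}. if p \<le> i + Suc t then c else \<one>)"
  proof (rule restrict_ext)
    fix i assume i: "i \<in> {..<p}"
    show "(\<lambda>i\<in>{..<p}. if p \<le> i + t then c else \<one>) ((i + 1) mod p)
        \<otimes> (\<lambda>i\<in>{..<p}. if i = p - 1 then c else \<one>) i = (if p \<le> i + Suc t then c else \<one>)"
    proof (cases "i = p - 1")
      case True
      then show ?thesis using Suc.prems c p_bounds by simp
    next
      case False
      then have "Suc i < p" using i by auto
      then show ?thesis using False c by simp
    qed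
  qed
  moreover have IH: "twist c [^]\<^bsub>W\<^esub> t = (t mod p, \<lambda>i\<in>{..<p}. if p \<le> i + t then c else \<one>)"
    using Suc.IH[OF Suc_leD[OF Suc.prems]] .
  moreover have "(t mod p + 1) mod p = Suc t mod p" by (simp add: mod_Suc_eq)
  ultimately show ?case unfolding W.nat_pow_Suc IH unfolding twist_def mult_wreath by (simp only:)
qed

lemma twist_pow_eq_one:
  assumes c: "c \<in> carrier G"
  shows "twist c [^]\<^bsub>W\<^esub> k = \<one>\<^bsub>W\<^esub> \<longleftrightarrow> p dvd k \<and> c [^] (k div p) = \<one>"
proof (cases "p dvd k")
  case True
  then obtain m where m: "k = p * m" by blast
  have x: "(\<lambda>i\<in>{..<p}. c) \<in> {..<p} \<rightarrow>\<^sub>E carrier G" using c by auto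
  have "(\<lambda>i\<in>{..<p}. if p \<le> i + p then c else \<one>) = (\<lambda>i\<in>{..<p}. c)" by (intro restrict_ext) simp
  then have "twist c [^]\<^bsub>W\<^esub> p = (0, \<lambda>i\<in>{..<p}. c)" using twist_pow[OF c, of p] by simp
  then have "twist c [^]\<^bsub>W\<^esub> k = (0, \<lambda>i\<in>{..<p}. c) [^]\<^bsub>W\<^esub> m"
    unfolding m using W.nat_pow_pow[OF twist_closed[OF c], of p m] by simp
  then show ?thesis using True base_pow_eq_one[OF x, of m] p_bounds m by auto
next
  case False
  have "fst (twist c [^]\<^bsub>W\<^esub> k) = k mod p" using fst_pow_W[OF twist_closed[OF c], of k] by (simp add: twist_def)
  with False show ?thesis by (metis dvd_eq_mod_eq_0 fst_conv one_wreath)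
qed

lemma card_base_commuting_twist:
  assumes c: "c \<in> carrier G"
  shows "card {x \<in> carrier W. fst x = 0 \<and> x \<otimes>\<^bsub>W\<^esub> twist c = twist c \<otimes>\<^bsub>W\<^esub> x \<and> x [^]\<^bsub>W\<^esub> (k::nat) = \<one>\<^bsub>W\<^esub>}
    = card {a \<in> carrier G. a \<otimes> c = c \<otimes> a \<and> a [^] k = \<one>}" (is "card ?X = card ?A")
proof -
  have "bij_betw (\<lambda>a. (0, \<lambda>i\<in>{..<p}. a)) ?A ?X"
  proof (rule bij_betwI')
    fix a b assume "a \<in> ?A" "b \<in> ?A"
    then show "((0::nat, \<lambda>i\<in>{..<p}. a) = (0, \<lambda>i\<in>{..<p}. b)) = (a = b)"
      using p_bounds by (auto simp: restrict_eq_iff)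
  next
    fix a assume a: "a \<in> ?A"
    then have x: "(\<lambda>i\<in>{..<p}. a) \<in> {..<p} \<rightarrow>\<^sub>E carrier G" by auto
    show "(0, \<lambda>i\<in>{..<p}. a) \<in> ?X"
      using a x base_times_twist_commute_iff[OF x c] base_pow_eq_one[OF x, of k] p_bounds
      by (simp add: carrier_wreath)
  next
    fix z assume z: "z \<in> ?X"
    then have "z \<in> carrier W" "fst z = 0" by blast+
    then obtain x where zx: "z = (0, x)" and x: "x \<in> {..<p} \<rightarrow>\<^sub>E carrier G"
      by (cases z) (simp add: carrier_wreath)
    have z': "(0, x) \<otimes>\<^bsub>W\<^esub> twist c = twist c \<otimes>\<^bsub>W\<^esub> (0, x)" "(0, x) [^]\<^bsub>W\<^esub> k = \<one>\<^bsub>W\<^esub>"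
      using z unfolding zx by blast+
    note R = z'(1)[unfolded base_times_twist_commute_iff[OF x c]]
    note 1 = R[THEN conjunct1] R[THEN conjunct2] and 2 = z'(2)[unfolded base_pow_eq_one[OF x]]
    have x0: "x 0 \<in> carrier G" using PiE_mem[OF x, of 0] p_bounds(1) by simp
    then have "(\<lambda>i\<in>{..<p}. x 0) \<in> {..<p} \<rightarrow>\<^sub>E carrier G" by simp
    then have "x = (\<lambda>i\<in>{..<p}. x 0)"
    proof (rule PiE_ext[OF x])
      show "x i = (\<lambda>i\<in>{..<p}. x 0) i" if "i \<in> {..<p}" for i
        unfolding restrict_apply'[OF that] using that 1(1)[rule_format, of i] by (simp only: lessThan_iff)
    qed
    then have "z = (0, \<lambda>i\<in>{..<p}. x 0)" unfolding zx by (rule arg_cong)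
    moreover have "x 0 \<in> ?A" using x0 1(2) 2[rule_format, OF p_bounds(1)] by (intro CollectI conjI)
    ultimately show "\<exists>a\<in>?A. z = (0, \<lambda>i\<in>{..<p}. a)" by (rule bexI)
  qed
  then show ?thesis by (rule bij_betw_same_card[symmetric])
qed

lemma card_centralizer_top_one:
  assumes u: "u \<in> carrier W" "fst u = 1"
  shows "card {y \<in> carrier W. u \<otimes>\<^bsub>W\<^esub> y = y \<otimes>\<^bsub>W\<^esub> u}
    = p * card {y \<in> carrier W. fst y = 0 \<and> u \<otimes>\<^bsub>W\<^esub> y = y \<otimes>\<^bsub>W\<^esub> u}"
proof -
  define Z where "Z j = {y \<in> carrier W. fst y = j \<and> u \<otimes>\<^bsub>W\<^esub> y = y \<otimes>\<^bsub>W\<^esub> u}" for j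
  have finZ: "finite (Z j)" for j unfolding Z_def using finite_W by simp
  \<comment> \<open>Multiplying by a power of u moves the fibres of the centralizer over the top group onto each other.\<close>
  have le: "card (Z j) \<le> card (Z ((j + t) mod p))" for j t
  proof (rule card_inj_on_le[where f = "\<lambda>y. u [^]\<^bsub>W\<^esub> t \<otimes>\<^bsub>W\<^esub> y"])
    show "inj_on (\<lambda>y. u [^]\<^bsub>W\<^esub> t \<otimes>\<^bsub>W\<^esub> y) (Z j)" using u unfolding Z_def by (intro inj_onI) auto
    show "(\<lambda>y. u [^]\<^bsub>W\<^esub> t \<otimes>\<^bsub>W\<^esub> y) ` Z j \<subseteq> Z ((j + t) mod p)"
    proof
      fix z assume "z \<in> (\<lambda>y. u [^]\<^bsub>W\<^esub> t \<otimes>\<^bsub>W\<^esub> y) ` Z j"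
      then obtain y where y: "z = u [^]\<^bsub>W\<^esub> t \<otimes>\<^bsub>W\<^esub> y" "y \<in> carrier W" "fst y = j" "u \<otimes>\<^bsub>W\<^esub> y = y \<otimes>\<^bsub>W\<^esub> u"
        unfolding Z_def by blast
      have "u \<otimes>\<^bsub>W\<^esub> z = u [^]\<^bsub>W\<^esub> t \<otimes>\<^bsub>W\<^esub> (u \<otimes>\<^bsub>W\<^esub> y)"
        unfolding y(1) using u y(2) W.comm_pow[OF u(1) u(1) refl, of t] by (simp add: W.m_assoc[symmetric])
      also have "\<dots> = z \<otimes>\<^bsub>W\<^esub> u" unfolding y(1,4) using u y(2) by (simp add: W.m_assoc)
      finally have "u \<otimes>\<^bsub>W\<^esub> z = z \<otimes>\<^bsub>W\<^esub> u" .
      moreover have "fst z = (j + t) mod p"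
        unfolding y(1) fst_mult_wreath fst_pow_W[OF u(1)] u(2) y(3) by (simp add: mod_add_right_eq add.commute)
      ultimately show "z \<in> Z ((j + t) mod p)" unfolding Z_def using u(1) y(1,2) by simp
    qed
  qed (rule finZ)
  have eq: "card (Z j) = card (Z 0)" if "j < p" for j
    using le[of j "p - j"] le[of 0 j] that by simp
  have "{y \<in> carrier W. u \<otimes>\<^bsub>W\<^esub> y = y \<otimes>\<^bsub>W\<^esub> u} = (\<Union>j\<in>{..<p}. Z j)"
    unfolding Z_def using fst_less by blast
  also have "card \<dots> = (\<Sum>j<p. card (Z j))"
  proof (intro card_UN_disjoint ballI impI)
    show "Z i \<inter> Z j = {}" if "i \<noteq> j" for i j using that unfolding Z_def by blast
  qed (simp_all add: finZ)
  also have "\<dots> = (\<Sum>j<p. card (Z 0))" by (intro sum.cong refl eq) simp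
  also have "\<dots> = p * card (Z 0)" by simp
  finally show ?thesis unfolding Z_def .
qed

text \<open>
  The map that sends \<open>(v, c)\<close>, with \<open>v\<close> a tuple starting with \<open>\<one>\<close>, to the conjugate of \<open>twist c\<close> by the
  inverse of \<open>v\<close> hits every element with top component 1 exactly once. It is injective since its value determines the
  coordinates of \<open>v\<close> one after the other and then \<open>c\<close>, and both sides have \<open>|G|\<^sup>p\<close> elements.
\<close>

lemma sum_top_one:
  fixes f :: "nat \<times> (nat \<Rightarrow> 'a) \<Rightarrow> nat"
  assumes inv: "\<And>g y. g \<in> carrier W \<Longrightarrow> y \<in> carrier W \<Longrightarrow> f (g \<otimes>\<^bsub>W\<^esub> y \<otimes>\<^bsub>W\<^esub> inv\<^bsub>W\<^esub> g) = f y"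
  shows "(\<Sum>y\<in>{y\<in>carrier W. fst y = 1}. f y) = order G ^ (p - 1) * (\<Sum>c\<in>carrier G. f (twist c))"
proof -
  define A where "A = {v \<in> {..<p} \<rightarrow>\<^sub>E carrier G. v 0 = \<one>}"
  define T where "T = {y \<in> carrier W. fst y = 1}"
  define F where "F = (\<lambda>(v, c). inv\<^bsub>W\<^esub> (0, v) \<otimes>\<^bsub>W\<^esub> twist c \<otimes>\<^bsub>W\<^esub> inv\<^bsub>W\<^esub> (inv\<^bsub>W\<^esub> (0, v)))"
  have Ap: "v \<in> {..<p} \<rightarrow>\<^sub>E carrier G" "v 0 = \<one>" "(0, v) \<in> carrier W" if "v \<in> A" for v
    using that p_bounds unfolding A_def carrier_wreath by simp_all
  have F_closed: "F (v, c) \<in> T" if "v \<in> A" "c \<in> carrier G" for v c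
    using fst_conj_W[of "inv\<^bsub>W\<^esub> (0, v)" "twist c"] Ap(3)[OF that(1)] twist_closed[OF that(2)]
    unfolding T_def F_def by (simp add: twist_def)
  have F_eq: "(0, v) \<otimes>\<^bsub>W\<^esub> F (v, c) = twist c \<otimes>\<^bsub>W\<^esub> (0, v)" if "v \<in> A" "c \<in> carrier G" for v c
    using Ap(3)[OF that(1)] twist_closed[OF that(2)]
    unfolding F_def by (simp add: W.m_assoc[symmetric])
  have F_coord: "v (Suc i mod p) \<otimes> g i = (if i = p - 1 then c else \<one>) \<otimes> v i"
    if v: "v \<in> A" and c: "c \<in> carrier G" and F: "F (v, c) = (1, g)" and i: "i < p" for v c g i
  proof -
    have "(\<lambda>i\<in>{..<p}. v ((i + 1) mod p) \<otimes> g i)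
        = (\<lambda>i\<in>{..<p}. (\<lambda>i\<in>{..<p}. if i = p - 1 then c else \<one>) ((i + 0) mod p) \<otimes> v i)"
      using F_eq[OF v c] unfolding F twist_def mult_wreath prod.inject by blast
    then have "v ((i + 1) mod p) \<otimes> g i = (\<lambda>i\<in>{..<p}. if i = p - 1 then c else \<one>) ((i + 0) mod p) \<otimes> v i"
      using i unfolding restrict_eq_iff by blast
    then show ?thesis using i by simp
  qed
  have inj: "inj_on F (A \<times> carrier G)"
  proof (rule inj_onI)
    fix x y assume "x \<in> A \<times> carrier G" "y \<in> A \<times> carrier G" and eq: "F x = F y"
    then obtain v c w d where x: "x = (v, c)" "v \<in> A" "c \<in> carrier G" and y: "y = (w, d)" "w \<in> A" "d \<in> carrier G"
      by blast
    have "F x \<in> T" using F_closed x by simp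
    then obtain g where g: "F x = (1, g)" and gc: "\<And>i. i < p \<Longrightarrow> g i \<in> carrier G"
      unfolding T_def carrier_wreath by force
    have vc: "v i \<in> carrier G" "w i \<in> carrier G" if "i < p" for i
      using Ap(1)[OF x(2)] Ap(1)[OF y(2)] that by auto
    have Fv: "F (v, c) = (1, g)" and Fw: "F (w, d) = (1, g)" using g eq x y by simp_all
    \<comment> \<open>The equation at position \<open>i\<close> expresses coordinate \<open>i + 1\<close> of the conjugator through coordinate \<open>i\<close>.\<close>
    have vw: "v i = w i" if "i < p" for i
      using that
    proof (induction i)
      case 0
      then show ?case using Ap(2)[OF x(2)] Ap(2)[OF y(2)] by simp
    next
      case (Suc i)
      then have "i \<noteq> p - 1" "i < p" by auto
      then have "v (Suc i) \<otimes> g i = v i" "w (Suc i) \<otimes> g i = w i"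
        using F_coord[OF x(2,3) Fv, of i] F_coord[OF y(2,3) Fw, of i] Suc vc[of i] by simp_all
      then have "v (Suc i) \<otimes> g i = w (Suc i) \<otimes> g i" using Suc by simp
      then show ?case using Suc vc[of "Suc i"] gc[of i] by simp
    qed
    have "v = w" using Ap(1) x y vw by (intro PiE_ext[of v "{..<p}" "\<lambda>_. carrier G" w]) auto
    moreover have "c \<otimes> v (p - 1) = d \<otimes> v (p - 1)"
      using F_coord[OF x(2,3) Fv, of "p - 1"] F_coord[OF y(2,3) Fw, of "p - 1"] p_bounds
        vw[of 0] vw[of "p - 1"] by simp
    then have "c = d" using x(3) y(3) vc[of "p - 1"] p_bounds by simp
    ultimately show "x = y" using x y by simp
  qed
  have finT: "finite T" unfolding T_def using finite_W by simp
  have card_T: "card T = order G ^ p"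
  proof -
    have "T = {1} \<times> ({..<p} \<rightarrow>\<^sub>E carrier G)" 
    proof (rule Set.set_eqI)
      show "y \<in> T \<longleftrightarrow> y \<in> {1} \<times> ({..<p} \<rightarrow>\<^sub>E carrier G)" for y
        unfolding T_def carrier_wreath using p_bounds(2) by (cases y) auto
    qed
    then show ?thesis by (simp add: card_cartesian_product card_PiE order_def)
  qed
  have card_A: "card A = order G ^ (p - 1)"
  proof -
    have "A = (\<Pi>\<^sub>E i\<in>{..<p}. if i = 0 then {\<one>} else carrier G)"
    proof (rule Set.set_eqI)
      fix v
      have "(\<forall>i\<in>{..<p}. v i \<in> carrier G) \<and> v 0 = \<one> \<longleftrightarrow>
          (\<forall>i\<in>{..<p}. v i \<in> (if i = 0 then {\<one>} else carrier G))" (is "?l \<longleftrightarrow> ?r")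
      proof
        assume ?l
        then show ?r by simp
      next
        assume r: ?r
        have "v 0 = \<one>" using bspec[OF r, of 0] p_bounds(1) by simp
        moreover have "v i \<in> carrier G" if "i \<in> {..<p}" for i
          using bspec[OF r that] by (simp split: if_splits)
        ultimately show ?l by blast
      qed
      then show "v \<in> A \<longleftrightarrow> v \<in> (\<Pi>\<^sub>E i\<in>{..<p}. if i = 0 then {\<one>} else carrier G)"
        unfolding A_def PiE_iff mem_Collect_eq by blast
    qed
    then have "card A = (\<Prod>i<p. card (if i = 0 then {\<one>} else carrier G))" by (simp add: card_PiE)
    also have "\<dots> = (\<Prod>i<Suc (p - 1). card (if i = 0 then {\<one>} else carrier G))" using p_bounds by simp
    also have "\<dots> = order G ^ (p - 1)" unfolding prod.lessThan_Suc_shift by (simp add: order_def)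
    finally show ?thesis .
  qed
  have "F ` (A \<times> carrier G) = T"
  proof (rule card_subset_eq[OF finT])
    show "F ` (A \<times> carrier G) \<subseteq> T" using F_closed by auto
    have "order G ^ (p - 1) * order G = order G ^ p" using p_bounds by (simp flip: power_Suc2)
    then show "card (F ` (A \<times> carrier G)) = card T"
      using card_A card_T by (simp add: card_image[OF inj] card_cartesian_product order_def)
  qed
  then have "bij_betw F (A \<times> carrier G) T" using inj by (simp add: bij_betw_def)
  then have "(\<Sum>y\<in>T. f y) = (\<Sum>z\<in>A \<times> carrier G. f (F z))" by (rule sum.reindex_bij_betw[symmetric])
  also have "\<dots> = (\<Sum>z\<in>A \<times> carrier G. f (twist (snd z)))"
  proof (intro sum.cong refl)
    fix z assume "z \<in> A \<times> carrier G"
    then obtain v c where z: "z = (v, c)" "v \<in> A" "c \<in> carrier G" by blast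
    then show "f (F z) = f (twist (snd z))"
      using inv[of "inv\<^bsub>W\<^esub> (0, v)" "twist c"] Ap(3) twist_closed unfolding F_def by simp
  qed
  also have "\<dots> = (\<Sum>v\<in>A. \<Sum>c\<in>carrier G. f (twist c))"
    unfolding sum.cartesian_product by (intro sum.cong refl) (simp add: case_prod_beta)
  also have "\<dots> = order G ^ (p - 1) * (\<Sum>c\<in>carrier G. f (twist c))" using card_A by simp
  finally show ?thesis unfolding T_def .
qed

text \<open>
  The elements with top component \<open>j \<noteq> 0\<close> are exactly the \<open>j\<close>-th powers of those with top component 1,
  so each of the \<open>p - 1\<close> nontrivial top components contributes the same amount.
\<close>

lemma sum_over_wreath:
  fixes f :: "nat \<times> (nat \<Rightarrow> 'a) \<Rightarrow> nat"
  assumes conj: "\<And>g y. g \<in> carrier W \<Longrightarrow> y \<in> carrier W \<Longrightarrow> f (g \<otimes>\<^bsub>W\<^esub> y \<otimes>\<^bsub>W\<^esub> inv\<^bsub>W\<^esub> g) = f y"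
    and pow: "\<And>t y. coprime t (order W) \<Longrightarrow> y \<in> carrier W \<Longrightarrow> f (y [^]\<^bsub>W\<^esub> t) = f y"
  shows "(\<Sum>y\<in>carrier W. f y) = (\<Sum>y\<in>{y\<in>carrier W. fst y = 0}. f y)
    + (p - 1) * order G ^ (p - 1) * (\<Sum>c\<in>carrier G. f (twist c))"
proof -
  define T where "T j = {y \<in> carrier W. fst y = j}" for j
  obtain e where e: "order W = p ^ e" using W_p_group ..
  have "p dvd order W" using p_bounds by (simp add: order_wreath)
  then have one: "(\<Sum>y\<in>T j. f y) = (\<Sum>y\<in>T 1. f y)" if j: "0 < j" "j < p" for j
  proof -
    assume pW: "p dvd order W"
    have cop: "coprime j (order W)"
    proof -
      \<comment> \<open>Since \<open>W\<close> is a \<open>p\<close>-group, \<open>y \<mapsto> y\<^sup>j\<close> is invertible and maps top component 1 to \<open>j\<close>.\<close>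
      have "\<not> p dvd j" using j by (auto dest: dvd_imp_le)
      then have "coprime p j" by (rule prime_imp_coprime[OF prime])
      then show ?thesis unfolding e by (simp add: coprime_commute)
    qed
    obtain s where s: "\<forall>x\<in>carrier W. (x [^]\<^bsub>W\<^esub> j) [^]\<^bsub>W\<^esub> s = x \<and> (x [^]\<^bsub>W\<^esub> s) [^]\<^bsub>W\<^esub> j = x"
      and sW: "j * s mod order W = 1 mod order W"
      using W.power_coprime_invertible[OF finite_W cop] by blast
    have "s * j mod p = 1 mod p" using sW pW by (metis mod_mod_cancel mult.commute)
    then have sj: "s * j mod p = 1" using p_bounds by simp
    have "bij_betw (\<lambda>y. y [^]\<^bsub>W\<^esub> j) (T 1) (T j)"
    proof (rule bij_betw_byWitness[where f' = "\<lambda>y. y [^]\<^bsub>W\<^esub> s"])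
      show "(\<lambda>y. y [^]\<^bsub>W\<^esub> j) ` T 1 \<subseteq> T j" unfolding T_def using fst_pow_W j by auto
      show "(\<lambda>y. y [^]\<^bsub>W\<^esub> s) ` T j \<subseteq> T 1" unfolding T_def using fst_pow_W sj by auto
    qed (use s in \<open>simp_all add: T_def\<close>)
    then have "(\<Sum>y\<in>T j. f y) = (\<Sum>y\<in>T 1. f (y [^]\<^bsub>W\<^esub> j))" by (rule sum.reindex_bij_betw[symmetric])
    also have "\<dots> = (\<Sum>y\<in>T 1. f y)" using pow[OF cop] unfolding T_def by (intro sum.cong) auto
    finally show ?thesis .
  qed
  have "carrier W = (\<Union>j\<in>{..<p}. T j)" unfolding T_def using fst_less by blast
  moreover have "(\<Sum>y\<in>(\<Union>j\<in>{..<p}. T j). f y) = (\<Sum>j<p. \<Sum>y\<in>T j. f y)"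
  proof (intro sum.UNION_disjoint ballI impI)
    show "finite (T j)" for j unfolding T_def using finite_W by simp
    show "T i \<inter> T j = {}" if "i \<noteq> j" for i j using that unfolding T_def by blast
  qed simp
  ultimately have "(\<Sum>y\<in>carrier W. f y) = (\<Sum>j<p. \<Sum>y\<in>T j. f y)" by simp
  also have "\<dots> = (\<Sum>y\<in>T 0. f y) + (\<Sum>j\<in>{0<..<p}. \<Sum>y\<in>T j. f y)"
  proof -
    have "{..<p} = insert 0 {0<..<p}" using p_bounds by auto
    then show ?thesis by simp
  qed
  also have "(\<Sum>j\<in>{0<..<p}. \<Sum>y\<in>T j. f y) = (\<Sum>j\<in>{0<..<p}. \<Sum>y\<in>T 1. f y)"
    by (intro sum.cong refl one) simp_all
  also have "\<dots> = (p - 1) * (\<Sum>y\<in>T 1. f y)" by simp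
  also have "(\<Sum>y\<in>T 1. f y) = order G ^ (p - 1) * (\<Sum>c\<in>carrier G. f (twist c))"
    unfolding T_def by (rule sum_top_one[OF conj])
  finally show ?thesis unfolding T_def by simp
qed

text \<open>
  In the base group both conditions are checked in each coordinate separately.
\<close>

lemma card_base_pairs:
  "card {(x, y). x \<in> {x\<in>carrier W. fst x = 0} \<and> y \<in> {y\<in>carrier W. fst y = 0} \<and>
      (x \<otimes>\<^bsub>W\<^esub> y = y \<otimes>\<^bsub>W\<^esub> x \<and> x [^]\<^bsub>W\<^esub> (k::nat) = \<one>\<^bsub>W\<^esub>)} = comm_count G k ^ p"
proof -
  define B where "B = {(a, b). a \<in> carrier G \<and> b \<in> carrier G \<and> a \<otimes> b = b \<otimes> a \<and> a [^] k = \<one>}"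
  have comm: "(0, x) \<otimes>\<^bsub>W\<^esub> (0, y) = (0, y) \<otimes>\<^bsub>W\<^esub> (0, x) \<longleftrightarrow> (\<forall>i<p. x i \<otimes> y i = y i \<otimes> x i)"
    for x y :: "nat \<Rightarrow> 'a"
  proof -
    have "(0, x) \<otimes>\<^bsub>W\<^esub> (0, y) = (0, y) \<otimes>\<^bsub>W\<^esub> (0, x) \<longleftrightarrow>
        (\<forall>i\<in>{..<p}. x ((i + 0) mod p) \<otimes> y i = y ((i + 0) mod p) \<otimes> x i)"
      unfolding mult_wreath prod.inject restrict_eq_iff by (simp only: simp_thms)
    also have "\<dots> \<longleftrightarrow> (\<forall>i\<in>{..<p}. x i \<otimes> y i = y i \<otimes> x i)" by (intro ball_cong refl) simp
    finally show ?thesis by (simp only: Ball_def lessThan_iff)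
  qed
  let ?S = "{(x, y). x \<in> {x\<in>carrier W. fst x = 0} \<and> y \<in> {y\<in>carrier W. fst y = 0} \<and>
      (x \<otimes>\<^bsub>W\<^esub> y = y \<otimes>\<^bsub>W\<^esub> x \<and> x [^]\<^bsub>W\<^esub> (k::nat) = \<one>\<^bsub>W\<^esub>)}"
  let ?F = "\<lambda>z. ((0::nat, \<lambda>i\<in>{..<p}. fst (z i)), (0::nat, \<lambda>i\<in>{..<p}. snd (z i)))"
  have "bij_betw ?F ({..<p} \<rightarrow>\<^sub>E B) ?S"
  proof (rule bij_betwI')
    fix z w assume z: "z \<in> {..<p} \<rightarrow>\<^sub>E B" and w: "w \<in> {..<p} \<rightarrow>\<^sub>E B"
    show "(?F z = ?F w) = (z = w)"
    proof
      assume "?F z = ?F w"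
      then have "\<forall>i\<in>{..<p}. fst (z i) = fst (w i)" "\<forall>i\<in>{..<p}. snd (z i) = snd (w i)"
        unfolding prod.inject restrict_eq_iff by blast+
      then show "z = w" using z w by (intro PiE_ext[OF z w]) (auto simp: prod_eq_iff)
    qed simp
  next
    fix z assume z: "z \<in> {..<p} \<rightarrow>\<^sub>E B"
    have zB: "fst (z i) \<in> carrier G" "snd (z i) \<in> carrier G" "fst (z i) \<otimes> snd (z i) = snd (z i) \<otimes> fst (z i)"
      "fst (z i) [^] k = \<one>" if "i < p" for i
    proof -
      have "z i \<in> B" using z that by auto
      then show "fst (z i) \<in> carrier G" "snd (z i) \<in> carrier G" "fst (z i) \<otimes> snd (z i) = snd (z i) \<otimes> fst (z i)"
        "fst (z i) [^] k = \<one>" unfolding B_def case_prod_beta by blast+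
    qed
    have x: "(\<lambda>i\<in>{..<p}. fst (z i)) \<in> {..<p} \<rightarrow>\<^sub>E carrier G" and y: "(\<lambda>i\<in>{..<p}. snd (z i)) \<in> {..<p} \<rightarrow>\<^sub>E carrier G"
      using zB by simp_all
    show "?F z \<in> ?S"
      unfolding mem_Collect_eq case_prod_conv comm base_pow_eq_one[OF x]
      using x y zB p_bounds by (simp add: carrier_wreath)
  next
    fix q assume q: "q \<in> ?S"
    obtain u v where uv: "q = (u, v)" by (cases q)
    have "u \<in> carrier W" "fst u = 0" "v \<in> carrier W" "fst v = 0"
      using q unfolding uv mem_Collect_eq case_prod_conv by blast+
    then obtain x y where "u = (0, x)" "x \<in> {..<p} \<rightarrow>\<^sub>E carrier G" "v = (0, y)" "y \<in> {..<p} \<rightarrow>\<^sub>E carrier G"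
      by (cases u; cases v) (simp add: carrier_wreath)
    with uv have xy: "q = ((0, x), (0, y))" "x \<in> {..<p} \<rightarrow>\<^sub>E carrier G" "y \<in> {..<p} \<rightarrow>\<^sub>E carrier G"
      by simp_all
    have c: "x i \<otimes> y i = y i \<otimes> x i" "x i [^] k = \<one>" if "i < p" for i
      using q that unfolding xy(1) mem_Collect_eq case_prod_conv comm base_pow_eq_one[OF xy(2)] by blast+
    define z where "z = (\<lambda>i\<in>{..<p}. (x i, y i))"
    have "z \<in> {..<p} \<rightarrow>\<^sub>E B" 
    proof -
      have "(x i, y i) \<in> B" if "i < p" for i
        using c[OF that] that xy(2,3) unfolding B_def mem_Collect_eq case_prod_conv by blast
      then show ?thesis unfolding z_def by simp
    qed
    moreover have "q = ?F z"
    proof -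
      have "(\<lambda>i\<in>{..<p}. fst (z i)) = (\<lambda>i\<in>{..<p}. x i)" "(\<lambda>i\<in>{..<p}. snd (z i)) = (\<lambda>i\<in>{..<p}. y i)"
        unfolding z_def by (intro restrict_ext; simp)+
      then show ?thesis
        unfolding xy(1) using PiE_restrict[OF xy(2)] PiE_restrict[OF xy(3)] by (simp only:)
    qed
    ultimately show "\<exists>z\<in>{..<p} \<rightarrow>\<^sub>E B. q = ?F z" by blast
  qed
  then have "card ?S = card ({..<p} \<rightarrow>\<^sub>E B)" by (rule bij_betw_same_card[symmetric])
  also have "\<dots> = card B ^ p" by (simp add: card_PiE)
  finally show ?thesis unfolding comm_count_def B_def .
qed

lemma W_pow_coprime:
  assumes t: "coprime t (order W)" and x: "x \<in> carrier W"
  shows "y \<in> carrier W \<Longrightarrow> x [^]\<^bsub>W\<^esub> t \<otimes>\<^bsub>W\<^esub> y = y \<otimes>\<^bsub>W\<^esub> x [^]\<^bsub>W\<^esub> t \<longleftrightarrow> x \<otimes>\<^bsub>W\<^esub> y = y \<otimes>\<^bsub>W\<^esub> x"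
    and "(x [^]\<^bsub>W\<^esub> t) [^]\<^bsub>W\<^esub> (k::nat) = \<one>\<^bsub>W\<^esub> \<longleftrightarrow> x [^]\<^bsub>W\<^esub> k = \<one>\<^bsub>W\<^esub>"
proof -
  obtain s :: nat where s': "\<forall>x\<in>carrier W. (x [^]\<^bsub>W\<^esub> t) [^]\<^bsub>W\<^esub> s = x \<and> (x [^]\<^bsub>W\<^esub> s) [^]\<^bsub>W\<^esub> t = x"
    using W.power_coprime_invertible[OF finite_W t] by blast
  then have s: "(z [^]\<^bsub>W\<^esub> t) [^]\<^bsub>W\<^esub> s = z" if "z \<in> carrier W" for z using that by blast
  have xt: "x [^]\<^bsub>W\<^esub> t \<in> carrier W" using x by simp
  show "x [^]\<^bsub>W\<^esub> t \<otimes>\<^bsub>W\<^esub> y = y \<otimes>\<^bsub>W\<^esub> x [^]\<^bsub>W\<^esub> t \<longleftrightarrow> x \<otimes>\<^bsub>W\<^esub> y = y \<otimes>\<^bsub>W\<^esub> x"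
    if y: "y \<in> carrier W"
    using W.comm_pow[OF y x, of t] W.comm_pow[OF y xt, of s] s[OF x] by metis
  have "(x [^]\<^bsub>W\<^esub> k) [^]\<^bsub>W\<^esub> t = \<one>\<^bsub>W\<^esub> \<longleftrightarrow> x [^]\<^bsub>W\<^esub> k = \<one>\<^bsub>W\<^esub>"
    using s[of "x [^]\<^bsub>W\<^esub> k"] x by (metis W.nat_pow_closed W.nat_pow_one)
  then show "(x [^]\<^bsub>W\<^esub> t) [^]\<^bsub>W\<^esub> (k::nat) = \<one>\<^bsub>W\<^esub> \<longleftrightarrow> x [^]\<^bsub>W\<^esub> k = \<one>\<^bsub>W\<^esub>"
    using x by (simp add: W.nat_pow_pow mult.commute)
qed

text \<open>
  The three summands come from pairs with both components in the base group, pairs with only the first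
  component in the base group, and pairs whose first component lies outside it. The first two kinds are summed over the second component,
  the last kind over the first component, each time by \<open>sum_over_wreath\<close>, so only the
  twists have to be examined.
\<close>

theorem comm_count_wreath:
  "comm_count W k = comm_count G k ^ p + (p - 1) * order G ^ (p - 1) * comm_count G k
    + (if p dvd k then (p - 1) * order G ^ (p - 1) * (p * comm_count G (k div p)) else 0)"
proof -
  let ?R = "\<lambda>x y. x \<otimes>\<^bsub>W\<^esub> y = y \<otimes>\<^bsub>W\<^esub> x \<and> x [^]\<^bsub>W\<^esub> k = \<one>\<^bsub>W\<^esub>"
  let ?B = "{x \<in> carrier W. fst x = 0}"
  have finB: "finite ?B" using finite_W by simp
  define g where "g x = card {y \<in> carrier W. ?R x y}" for x
  define h where "h y = card {x \<in> ?B. ?R x y}" for y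
  have g_alt: "g x = (if x [^]\<^bsub>W\<^esub> k = \<one>\<^bsub>W\<^esub>
      then card {y \<in> carrier W. y \<otimes>\<^bsub>W\<^esub> x = x \<otimes>\<^bsub>W\<^esub> y \<and> y [^]\<^bsub>W\<^esub> (0::nat) = \<one>\<^bsub>W\<^esub>} else 0)" for x
    unfolding g_def by (auto intro!: arg_cong[where f = card])
  have g_conj: "g (z \<otimes>\<^bsub>W\<^esub> x \<otimes>\<^bsub>W\<^esub> inv\<^bsub>W\<^esub> z) = g x" if "z \<in> carrier W" "x \<in> carrier W" for z x
  proof -
    have "(z \<otimes>\<^bsub>W\<^esub> x \<otimes>\<^bsub>W\<^esub> inv\<^bsub>W\<^esub> z) [^]\<^bsub>W\<^esub> k = \<one>\<^bsub>W\<^esub> \<longleftrightarrow> x [^]\<^bsub>W\<^esub> k = \<one>\<^bsub>W\<^esub>"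
      using W.pow_eq_id[of x k] W.pow_eq_id[of "z \<otimes>\<^bsub>W\<^esub> x \<otimes>\<^bsub>W\<^esub> inv\<^bsub>W\<^esub> z" k] W.ord_conj[OF that] that by simp
    moreover have "card {y \<in> carrier W. y \<otimes>\<^bsub>W\<^esub> (z \<otimes>\<^bsub>W\<^esub> x \<otimes>\<^bsub>W\<^esub> inv\<^bsub>W\<^esub> z) = (z \<otimes>\<^bsub>W\<^esub> x \<otimes>\<^bsub>W\<^esub> inv\<^bsub>W\<^esub> z) \<otimes>\<^bsub>W\<^esub> y
          \<and> y [^]\<^bsub>W\<^esub> (0::nat) = \<one>\<^bsub>W\<^esub>}
        = card {y \<in> carrier W. y \<otimes>\<^bsub>W\<^esub> x = x \<otimes>\<^bsub>W\<^esub> y \<and> y [^]\<^bsub>W\<^esub> (0::nat) = \<one>\<^bsub>W\<^esub>}"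
      using that by (intro W.card_commuting_conj) auto
    ultimately show ?thesis unfolding g_alt by presburger
  qed
  have g_pow: "g (x [^]\<^bsub>W\<^esub> t) = g x" if "coprime t (order W)" "x \<in> carrier W" for t x
    unfolding g_def using W_pow_coprime[OF that]
    by (intro arg_cong[where f = card] Collect_cong) blast
  have h_conj: "h (z \<otimes>\<^bsub>W\<^esub> y \<otimes>\<^bsub>W\<^esub> inv\<^bsub>W\<^esub> z) = h y" if "z \<in> carrier W" "y \<in> carrier W" for z y
    unfolding h_def
  proof (rule W.card_commuting_conj[OF that])
    show "z \<otimes>\<^bsub>W\<^esub> x \<otimes>\<^bsub>W\<^esub> inv\<^bsub>W\<^esub> z \<in> ?B" if "x \<in> ?B" for x
      using that \<open>z \<in> carrier W\<close> fst_conj_W[of z x] by simp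
    show "inv\<^bsub>W\<^esub> z \<otimes>\<^bsub>W\<^esub> x \<otimes>\<^bsub>W\<^esub> z \<in> ?B" if "x \<in> ?B" for x
      using that \<open>z \<in> carrier W\<close> fst_conj_W[of "inv\<^bsub>W\<^esub> z" x] by simp
  qed auto
  have h_pow: "h (y [^]\<^bsub>W\<^esub> t) = h y" if "coprime t (order W)" "y \<in> carrier W" for t y
  proof -
    have "x \<otimes>\<^bsub>W\<^esub> y [^]\<^bsub>W\<^esub> t = y [^]\<^bsub>W\<^esub> t \<otimes>\<^bsub>W\<^esub> x \<longleftrightarrow> x \<otimes>\<^bsub>W\<^esub> y = y \<otimes>\<^bsub>W\<^esub> x" if "x \<in> carrier W" for x
      unfolding eq_commute[of "x \<otimes>\<^bsub>W\<^esub> y [^]\<^bsub>W\<^esub> t"] eq_commute[of "x \<otimes>\<^bsub>W\<^esub> y"]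
      by (rule W_pow_coprime(1)) fact+
    then show ?thesis unfolding h_def by (intro arg_cong[where f = card] Collect_cong) blast
  qed
  have g_twist: "g (twist c) = (if p dvd k \<and> c [^] (k div p) = \<one>
      then p * card {a \<in> carrier G. c \<otimes> a = a \<otimes> c} else 0)" if c: "c \<in> carrier G" for c
  proof -
    have "card {y \<in> carrier W. twist c \<otimes>\<^bsub>W\<^esub> y = y \<otimes>\<^bsub>W\<^esub> twist c} = p * card {a \<in> carrier G. c \<otimes> a = a \<otimes> c}"
    proof -
      have "{y \<in> carrier W. fst y = 0 \<and> twist c \<otimes>\<^bsub>W\<^esub> y = y \<otimes>\<^bsub>W\<^esub> twist c}
          = {y \<in> carrier W. fst y = 0 \<and> y \<otimes>\<^bsub>W\<^esub> twist c = twist c \<otimes>\<^bsub>W\<^esub> y \<and> y [^]\<^bsub>W\<^esub> (0::nat) = \<one>\<^bsub>W\<^esub>}"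
        by (intro Collect_cong) (metis W.nat_pow_0)
      moreover have "{a \<in> carrier G. c \<otimes> a = a \<otimes> c}
          = {a \<in> carrier G. a \<otimes> c = c \<otimes> a \<and> a [^] (0::nat) = \<one>}"
        by (intro Collect_cong) (metis nat_pow_0)
      moreover have "fst (twist c) = 1" by (simp add: twist_def)
      ultimately show ?thesis
        using card_centralizer_top_one[OF twist_closed[OF c]] card_base_commuting_twist[OF c, of 0]
        by (simp only:)
    qed
    moreover have "{y \<in> carrier W. ?R (twist c) y} = (if p dvd k \<and> c [^] (k div p) = \<one>
        then {y \<in> carrier W. twist c \<otimes>\<^bsub>W\<^esub> y = y \<otimes>\<^bsub>W\<^esub> twist c} else {})"
      unfolding twist_pow_eq_one[OF c] by (simp split: if_split)
    ultimately show ?thesis unfolding g_def by simp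
  qed
  have h_twist: "h (twist c) = card {a \<in> carrier G. a \<otimes> c = c \<otimes> a \<and> a [^] k = \<one>}" if c: "c \<in> carrier G" for c
    unfolding h_def using card_base_commuting_twist[OF c, of k] by (simp add: conj_assoc)
  have "(\<Sum>y\<in>?B. h y) = comm_count G k ^ p"
    unfolding h_def using card_pairs_eq_sum(2)[OF finB finB, of ?R] card_base_pairs[of k] by simp
  moreover have "(\<Sum>c\<in>carrier G. h (twist c)) = comm_count G k"
    unfolding comm_count_def card_pairs_eq_sum(2)[OF fin fin] by (intro sum.cong refl h_twist)
  ultimately have hsum: "(\<Sum>y\<in>carrier W. h y)
      = comm_count G k ^ p + (p - 1) * order G ^ (p - 1) * comm_count G k"
    using sum_over_wreath[of h, OF h_conj h_pow] by simp
  \<comment> \<open>Pairs with first component in the base group, counted from the other side.\<close>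
  have gB: "(\<Sum>x\<in>?B. g x) = (\<Sum>y\<in>carrier W. h y)"
    unfolding g_def h_def using card_pairs_eq_sum[OF finB finite_W, of ?R] by simp
  have "(\<Sum>c\<in>carrier G. g (twist c)) = (if p dvd k then p * comm_count G (k div p) else 0)"
  proof (cases "p dvd k")
    case True
    have "(\<Sum>c\<in>carrier G. g (twist c))
        = (\<Sum>c\<in>carrier G. p * card {a \<in> carrier G. c \<otimes> a = a \<otimes> c \<and> c [^] (k div p) = \<one>})"
      by (intro sum.cong refl) (simp add: g_twist True)
    also have "\<dots> = p * comm_count G (k div p)"
      unfolding comm_count_def card_pairs_eq_sum(1)[OF fin fin] by (simp add: sum_distrib_left)
    finally show ?thesis using True by simp
  qed (simp add: g_twist)
  moreover have "comm_count W k = (\<Sum>x\<in>carrier W. g x)"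
    unfolding comm_count_def g_def by (rule card_pairs_eq_sum(1)[OF finite_W finite_W])
  moreover have "(\<Sum>x\<in>carrier W. g x) = (\<Sum>x\<in>?B. g x)
      + (p - 1) * order G ^ (p - 1) * (\<Sum>c\<in>carrier G. g (twist c))"
    by (rule sum_over_wreath[OF g_conj g_pow])
  ultimately have "comm_count W k = comm_count G k ^ p + (p - 1) * order G ^ (p - 1) * comm_count G k
      + (p - 1) * order G ^ (p - 1) * (if p dvd k then p * comm_count G (k div p) else 0)"
    using gB hsum by (simp only:)
  then show ?thesis by (cases "p dvd k") simp_all
qed

end

section \<open>Conjugacy of Sylow subgroups\<close>

lemma (in group) right_coset_action:
  assumes H: "subgroup H G" and Q: "subgroup Q G"
  shows "group_action (G\<lparr>carrier := Q\<rparr>) (rcosets H) (\<lambda>q. \<lambda>M\<in>rcosets H. M #> inv q)"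
proof -
  let ?\<phi> = "\<lambda>q. \<lambda>M\<in>rcosets H. M #> inv q"
  have HG: "H \<subseteq> carrier G" using H by (rule subgroup.subset)
  have QG: "q \<in> carrier G" if "q \<in> Q" for q using Q that by (rule subgroup.mem_carrier)
  have sub: "M \<subseteq> carrier G" if "M \<in> rcosets H" for M
    using that HG unfolding RCOSETS_def by (auto dest: r_coset_subset_G[OF HG])
  have closed: "M #> g \<in> rcosets H" if M: "M \<in> rcosets H" and g: "g \<in> carrier G" for M g
  proof -
    obtain a where "a \<in> carrier G" "M = H #> a" using M unfolding RCOSETS_def by blast
    then have "M #> g = H #> (a \<otimes> g)" "a \<otimes> g \<in> carrier G" using g HG by (simp_all add: coset_mult_assoc)
    then show ?thesis unfolding RCOSETS_def by blast
  qed
  have bij: "?\<phi> q \<in> Bij (rcosets H)" if q: "q \<in> Q" for q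
  proof -
    have "bij_betw (?\<phi> q) (rcosets H) (rcosets H)"
    proof (rule bij_betw_byWitness[where f' = "\<lambda>M. M #> q"])
      show "\<forall>M\<in>rcosets H. ?\<phi> q M #> q = M"
        using sub QG[OF q] by (simp add: coset_mult_assoc)
      show "\<forall>M\<in>rcosets H. ?\<phi> q (M #> q) = M"
        using sub QG[OF q] closed by (simp add: coset_mult_assoc)
      show "?\<phi> q ` (rcosets H) \<subseteq> rcosets H" "(\<lambda>M. M #> q) ` (rcosets H) \<subseteq> rcosets H"
        using closed QG[OF q] by auto
    qed
    then show ?thesis unfolding Bij_def by simp
  qed
  have "?\<phi> (q \<otimes> r) = compose (rcosets H) (?\<phi> q) (?\<phi> r)" if q: "q \<in> Q" and r: "r \<in> Q" for q r
    unfolding compose_def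
  proof (rule restrict_ext)
    fix M assume M: "M \<in> rcosets H"
    show "M #> inv (q \<otimes> r) = ?\<phi> q (?\<phi> r M)"
      using M sub[OF M] closed[OF M] QG[OF q] QG[OF r] by (simp add: coset_mult_assoc inv_mult_group)
  qed
  then have "?\<phi> \<in> hom (G\<lparr>carrier := Q\<rparr>) (BijGroup (rcosets H))"
    using bij by (simp add: hom_def BijGroup_def)
  then show ?thesis
    using subgroup_imp_group[OF Q] group_BijGroup
    by (simp add: group_action_def group_hom_def group_hom_axioms_def)
qed

text \<open>
  Every orbit size divides the order of the acting \<open>p\<close>-group, so an orbit whose size is prime to \<open>p\<close> is a
  single point, and not all orbit sizes can be divisible by \<open>p\<close>.
\<close>

lemma (in group_action) p_group_fixed_point:
  assumes p: "prime p" and ordG: "order G = p ^ e" and fin: "finite E" and E: "\<not> p dvd card E"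
  obtains x where "x \<in> E" "\<And>g. g \<in> carrier G \<Longrightarrow> \<phi> g x = x"
proof -
  have "\<exists>C\<in>orbits G E \<phi>. \<not> p dvd card C"
  proof (rule ccontr)
    assume "\<not> (\<exists>C\<in>orbits G E \<phi>. \<not> p dvd card C)"
    then have "p dvd (\<Sum>C\<in>orbits G E \<phi>. card C)" by (intro dvd_sum) blast
    also have "(\<Sum>C\<in>orbits G E \<phi>. card C) = (\<Sum>C\<in>orbits G E \<phi>. \<Sum>x\<in>C. 1)" by simp
    also have "\<dots> = card E" using disjoint_sum[OF fin, of "\<lambda>_. 1::nat"] by simp
    finally show False using E by blast
  qed
  then obtain x where x: "x \<in> E" "\<not> p dvd card (orbit G \<phi> x)"
    unfolding orbits_def by blast
  have "card (orbit G \<phi> x) dvd p ^ e" using orbit_stabilizer_theorem[OF x(1)] ordG by (metis dvd_triv_left)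
  then obtain k where "card (orbit G \<phi> x) = p ^ k" using p by (auto simp: divides_primepow_nat)
  with x(2) have "card (orbit G \<phi> x) = 1" by (cases k) auto
  then have orb: "orbit G \<phi> x = {x}" using orbit_refl[OF x(1)] by (metis card_1_singletonE singletonD)
  have "\<phi> g x = x" if "g \<in> carrier G" for g
  proof -
    have "\<phi> g x \<in> orbit G \<phi> x" unfolding orbit_def using that by blast
    then show ?thesis unfolding orb by simp
  qed
  with x(1) show thesis by (rule that)
qed

text \<open>
  \<open>Q\<close> acts on the cosets of \<open>H\<close>, whose number is prime to \<open>p\<close>. A fixed coset \<open>Ha\<close> satisfies \<open>Haq = Ha\<close> for
  all \<open>q \<in> Q\<close>, that is, \<open>aQa\<^sup>-\<^sup>1 \<subseteq> H\<close>, and the cardinalities agree.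
\<close>

theorem (in group) sylow_subgroups_conjugate:
  assumes p: "prime p" and fin: "finite (carrier G)"
    and H: "sylow_subgroup p G H" and Q: "sylow_subgroup p G Q"
  obtains a where "a \<in> carrier G" "(\<lambda>q. a \<otimes> q \<otimes> inv a) ` Q = H"
proof -
  define v where "v = multiplicity p (order G)"
  have sH: "subgroup H G" "card H = p ^ v" and sQ: "subgroup Q G" "card Q = p ^ v"
    using H Q unfolding sylow_subgroup_def v_def by auto
  interpret act: group_action "G\<lparr>carrier := Q\<rparr>" "rcosets H" "\<lambda>q. \<lambda>M\<in>rcosets H. M #> inv q"
    by (rule right_coset_action[OF sH(1) sQ(1)])
  have "order G \<noteq> 0" using fin order_gt_0_iff_finite by simp
  moreover have "card (rcosets H) * p ^ v = order G" using lagrange[OF sH(1)] sH(2) by simp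
  \<comment> \<open>Otherwise the order of the group would be divisible by \<open>p\<^bsup>v+1\<^esup>\<close>.\<close>
  ultimately have "\<not> p dvd card (rcosets H)"
    using multiplicity_decompose'[of "order G" p] p
    by (metis dvd_mult_cancel2 mult_dvd_mono multiplicity_dvd_iff_dvd not_prime_unit power_Suc power_dvd_iff_le_multiplicity Suc_n_not_le_n v_def dvd_refl)
  moreover have "order (G\<lparr>carrier := Q\<rparr>) = p ^ v" using sQ(2) by (simp add: order_def)
  moreover have "finite (rcosets H)" using fin by (simp add: RCOSETS_def)
  ultimately obtain M where M: "M \<in> rcosets H" "\<And>q. q \<in> Q \<Longrightarrow> M #> inv q = M"
    using act.p_group_fixed_point[OF p, of v] by auto
  obtain a where a: "a \<in> carrier G" "M = H #> a" using M(1) unfolding RCOSETS_def by blast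
  have "a \<otimes> q \<otimes> inv a \<in> H" if q: "q \<in> Q" for q
  proof -
    have qG: "q \<in> carrier G" using sQ(1) q by (rule subgroup.mem_carrier)
    have HG: "H \<subseteq> carrier G" using sH(1) by (rule subgroup.subset)
    have "M #> inv (inv q) = M" using M(2) subgroup.m_inv_closed[OF sQ(1) q] .
    then have "H #> (a \<otimes> q) = H #> a" using a qG HG by (simp add: coset_mult_assoc)
    then have "a \<otimes> q \<in> H #> a" using rcos_self[OF _ sH(1), of "a \<otimes> q"] a(1) qG by auto
    then show ?thesis using subgroup.rcos_module_imp[OF sH(1) is_group a(1)] by simp
  qed
  then have sub: "(\<lambda>q. a \<otimes> q \<otimes> inv a) ` Q \<subseteq> H" by blast
  have inj: "inj_on (\<lambda>q. a \<otimes> q \<otimes> inv a) Q"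
    using a(1) subgroup.mem_carrier[OF sQ(1)] by (intro inj_onI) simp
  have "finite H" using subgroup.subset[OF sH(1)] fin by (rule finite_subset)
  then have "(\<lambda>q. a \<otimes> q \<otimes> inv a) ` Q = H"
    using sub sH(2) sQ(2) by (intro card_subset_eq) (simp_all add: card_image[OF inj])
  with a(1) show thesis by (rule that)
qed

lemma (in group) sylow_subgroups_isomorphic:
  assumes "prime p" "finite (carrier G)" "sylow_subgroup p G H" "sylow_subgroup p G Q"
  shows "\<exists>\<psi>. \<psi> \<in> iso (G\<lparr>carrier := Q\<rparr>) (G\<lparr>carrier := H\<rparr>)"
proof -
  obtain a where a: "a \<in> carrier G" and img: "(\<lambda>q. a \<otimes> q \<otimes> inv a) ` Q = H"
    using sylow_subgroups_conjugate[OF assms] .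
  have QG: "q \<in> carrier G" if "q \<in> Q" for q
    using assms(4) that unfolding sylow_subgroup_def by (blast intro: subgroup.mem_carrier)
  have "inv a \<otimes> (a \<otimes> (b \<otimes> inv a)) = b \<otimes> inv a" if "b \<in> carrier G" for b
    using a that by (simp add: m_assoc[symmetric])
  then have "(\<lambda>q. a \<otimes> q \<otimes> inv a) \<in> hom (G\<lparr>carrier := Q\<rparr>) (G\<lparr>carrier := H\<rparr>)"
    using a QG img by (auto simp: hom_def m_assoc)
  moreover have "inj_on (\<lambda>q. a \<otimes> q \<otimes> inv a) Q" using a QG by (intro inj_onI) simp
  ultimately show ?thesis using img by (intro exI[of _ "\<lambda>q. a \<otimes> q \<otimes> inv a"]) (simp add: iso_def bij_betw_def)
qed


section \<open>The recurrence for the class numbers and its tails\<close>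

text \<open>
  The number of classes of \<open>P\<^sub>n\<close> of order dividing \<open>p\<^sup>i\<close> (\<open>card_classes_sylow\<close>). It is real-valued
  because the recurrence divides by \<open>p\<close>.
\<close>

fun class_count :: "nat \<Rightarrow> nat \<Rightarrow> nat \<Rightarrow> real" where
  "class_count p 0 i = 1"
| "class_count p (Suc n) i =
     (class_count p n i ^ p + (real p - 1) * class_count p n i) / real p
     + (case i of 0 \<Rightarrow> 0 | Suc j \<Rightarrow> (real p - 1) * class_count p n j)"

text \<open>
  The exponent of \<open>P\<^sub>n\<close> is \<open>p\<^sup>n\<close>, so \<open>i = n\<close> already captures all classes
  (\<open>class_count_eq_total\<close>).
\<close>

abbreviation total_count :: "nat \<Rightarrow> nat \<Rightarrow> real" where
  "total_count p n \<equiv> class_count p n n"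

lemma class_count_ge_1:
  assumes "p \<ge> 2"
  shows "1 \<le> class_count p n i"
proof (induction n arbitrary: i)
  case (Suc n)
  have "1 \<le> class_count p n i ^ p" by (simp add: Suc)
  moreover have "real p - 1 \<le> (real p - 1) * class_count p n i"
    using assms Suc[of i] by simp
  ultimately have "real p \<le> class_count p n i ^ p + (real p - 1) * class_count p n i" by linarith
  then have "1 \<le> (class_count p n i ^ p + (real p - 1) * class_count p n i) / real p"
    using assms by simp
  moreover have "0 \<le> (case i of 0 \<Rightarrow> 0 | Suc j \<Rightarrow> (real p - 1) * class_count p n j)"
  proof (cases i)
    case (Suc j)
    then show ?thesis using assms Suc.IH[of j] by simp
  qed simp
  ultimately show ?case by simp
qed simp

lemma class_count_pos: "p \<ge> 2 \<Longrightarrow> 0 < class_count p n i"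
  using class_count_ge_1[of p n i] by linarith

lemma class_count_mono:
  assumes "p \<ge> 2" "i \<le> j"
  shows "class_count p n i \<le> class_count p n j"
  using assms(2)
proof (induction n arbitrary: i j)
  case (Suc n)
  have "class_count p n i \<le> class_count p n j" using Suc by blast
  moreover have "0 \<le> class_count p n i" using class_count_ge_1[OF assms(1), of n i] by simp
  ultimately have "class_count p n i ^ p + (real p - 1) * class_count p n i
      \<le> class_count p n j ^ p + (real p - 1) * class_count p n j"
    using assms(1) by (intro add_mono power_mono mult_left_mono) auto
  moreover have "(case i of 0 \<Rightarrow> 0 | Suc k \<Rightarrow> (real p - 1) * class_count p n k)
      \<le> (case j of 0 \<Rightarrow> 0 | Suc k \<Rightarrow> (real p - 1) * class_count p n k)"
  proof (cases i)
    case 0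
    then show ?thesis using assms(1) class_count_pos[OF assms(1), of n]
      by (auto split: nat.splits simp: less_imp_le)
  next
    case (Suc k)
    then obtain l where "j = Suc l" "k \<le> l" using Suc.prems by (cases j) auto
    then show ?thesis using Suc Suc.IH assms(1) by (auto intro!: mult_left_mono)
  qed
  ultimately show ?case using assms(1) by (auto intro!: add_mono divide_right_mono)
qed simp

lemma class_count_eq_total: "n \<le> i \<Longrightarrow> class_count p n i = total_count p n"
proof (induction n arbitrary: i)
  case (Suc n)
  then obtain j where j: "i = Suc j" "n \<le> j" by (cases i) auto
  then have "class_count p n (Suc j) = total_count p n" "class_count p n j = total_count p n"
    "class_count p n (Suc n) = total_count p n"
    using Suc.IH[of "Suc j"] Suc.IH[of j] Suc.IH[of "Suc n"] by auto
  then show ?case using j by simp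
qed simp

lemma class_count_le_total: "p \<ge> 2 \<Longrightarrow> class_count p n i \<le> total_count p n"
  using class_count_mono[of p i n n] class_count_eq_total[of n i p] by (cases "i \<le> n") auto

lemma total_count_Suc:
  assumes "p \<ge> 2"
  shows "total_count p (Suc n) =
    (total_count p n ^ p + ((real p)\<^sup>2 - 1) * total_count p n) / real p"
  using assms class_count_eq_total[of n "Suc n" p] by (simp add: field_simps power2_eq_square)

lemma class_count_Suc_le:
  assumes "p \<ge> 2"
  shows "class_count p (Suc n) i \<le>
    (class_count p n i ^ p + ((real p)\<^sup>2 - 1) * class_count p n i) / real p"
proof -
  have "(case i of 0 \<Rightarrow> 0 | Suc j \<Rightarrow> (real p - 1) * class_count p n j) \<le> (real p - 1) * class_count p n i"
    using assms class_count_mono[OF assms, of _ i n] class_count_pos[OF assms, of n 0]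
    by (auto split: nat.splits)
  moreover have "(class_count p n i ^ p + (real p - 1) * class_count p n i) / real p
      + (real p - 1) * class_count p n i
      = (class_count p n i ^ p + ((real p)\<^sup>2 - 1) * class_count p n i) / real p"
    using assms by (simp add: field_simps power2_eq_square)
  ultimately show ?thesis by simp
qed

declare class_count.simps(2) [simp del]

text \<open>
  The induction runs for \<open>p K\<^sub>n\<close>: it satisfies \<open>p K\<^bsub>n+1\<^esub> \<le> (p K\<^sub>n)\<^sup>p\<close>.
\<close>

lemma total_count_upper:
  assumes "p \<ge> 2"
  shows "total_count p n \<le> real p ^ (p ^ n)"
proof -
  have "real p * total_count p n \<le> real p ^ (p ^ n)"
  proof (induction n)
    case (Suc n)
    let ?K = "total_count p n"
    have K1: "1 \<le> ?K" using class_count_ge_1[OF assms] .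
    have "?K \<le> ?K ^ p" using self_le_power[OF K1] assms by simp
    then have "?K ^ p + ((real p)\<^sup>2 - 1) * ?K \<le> ?K ^ p + ((real p)\<^sup>2 - 1) * ?K ^ p"
      using assms by (intro add_left_mono mult_left_mono) auto
    also have "\<dots> = (real p)\<^sup>2 * ?K ^ p" by (simp add: algebra_simps)
    also have "\<dots> \<le> (real p) ^ p * ?K ^ p"
      using assms K1 by (intro mult_right_mono power_increasing) auto
    also have "\<dots> = (real p * ?K) ^ p" by (simp add: power_mult_distrib)
    also have "\<dots> \<le> (real p ^ (p ^ n)) ^ p"
      using Suc K1 assms by (intro power_mono) auto
    also have "\<dots> = real p ^ (p ^ Suc n)" by (simp flip: power_mult add: mult.commute)
    finally show ?case using assms total_count_Suc[OF assms, of n] by simp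
  qed (use assms in simp)
  moreover have "total_count p n \<le> real p * total_count p n"
    using assms class_count_ge_1[OF assms, of n n] by (simp add: mult_le_cancel_right1)
  ultimately show ?thesis by linarith
qed

text \<open>
  The induction runs for \<open>K\<^sub>n / p\<close>, since \<open>K\<^bsub>n+1\<^esub> / p \<ge> (K\<^sub>n / p)\<^sup>p\<close>. It starts at \<open>n = 2\<close>:
  there the quotient is at least 2, while \<open>K\<^sub>1 / p = 1\<close> would not grow.
\<close>

lemma total_count_lower:
  assumes "p \<ge> 2"
  shows "2 ^ (p ^ n) \<le> total_count p (n + 2)"
proof -
  have "real p * 2 ^ (p ^ n) \<le> total_count p (n + 2)"
  proof (induction n)
    case 0
    have 1: "total_count p 1 = real p" using assms by (simp add: class_count.simps(2) field_simps power2_eq_square)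
    have "real p \<le> real p ^ p" using assms by (intro self_le_power) auto
    moreover have "2 * (real p)\<^sup>2 \<le> real p * (real p)\<^sup>2"
      using assms by (intro mult_right_mono) auto
    moreover have "((real p)\<^sup>2 - 1) * real p = real p * (real p)\<^sup>2 - real p"
      by (simp add: algebra_simps)
    ultimately have "2 * (real p)\<^sup>2 \<le> real p ^ p + ((real p)\<^sup>2 - 1) * real p" by linarith
    then have "2 * real p \<le> (real p ^ p + ((real p)\<^sup>2 - 1) * real p) / real p"
      using assms by (simp add: field_simps power2_eq_square)
    then show ?case using total_count_Suc[OF assms, of 1] 1 by (simp add: numeral_2_eq_2)
  next
    case (Suc n)
    let ?K = "total_count p (n + 2)"
    have K1: "1 \<le> ?K" using class_count_ge_1[OF assms] .
    have "real p * (real p * 2 ^ (p ^ Suc n)) = (real p)\<^sup>2 * (2 ^ (p ^ n)) ^ p"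
      by (simp add: power2_eq_square mult.commute flip: power_mult)
    also have "\<dots> \<le> real p ^ p * (2 ^ (p ^ n)) ^ p"
      using assms by (intro mult_right_mono power_increasing) auto
    also have "\<dots> = (real p * 2 ^ (p ^ n)) ^ p" by (simp add: power_mult_distrib)
    also have "\<dots> \<le> ?K ^ p" using Suc by (intro power_mono) auto
    also have "\<dots> \<le> ?K ^ p + ((real p)\<^sup>2 - 1) * ?K" using assms K1 by simp
    finally have "real p * 2 ^ (p ^ Suc n) \<le> (?K ^ p + ((real p)\<^sup>2 - 1) * ?K) / real p"
      using assms by (simp add: pos_le_divide_eq mult.commute)
    then show ?case using total_count_Suc[OF assms, of "n + 2"] by simp
  qed
  moreover have "(2::real) ^ (p ^ n) \<le> real p * 2 ^ (p ^ n)" using assms by simp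
  ultimately show ?thesis by linarith
qed

lemma total_count_mono:
  assumes "p \<ge> 2" "m \<le> n"
  shows "total_count p m \<le> total_count p n"
  using assms(2)
proof (induction n rule: dec_induct)
  case (step n)
  let ?K = "total_count p n"
  have K1: "1 \<le> ?K" using class_count_ge_1[OF assms(1)] .
  have "real p * ?K \<le> ?K + ((real p)\<^sup>2 - 1) * ?K"
    using K1 assms(1) by (simp add: algebra_simps power2_eq_square)
  moreover have "?K \<le> ?K ^ p" using self_le_power[OF K1] assms(1) by simp
  ultimately have "?K * real p \<le> ?K ^ p + ((real p)\<^sup>2 - 1) * ?K" by (simp add: mult.commute)
  then have "?K \<le> total_count p (Suc n)"
    unfolding total_count_Suc[OF assms(1)] using assms(1) by (simp add: pos_le_divide_eq)
  with step show ?case by linarith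
qed simp

lemma power_diff_le:
  fixes x y :: real
  assumes "0 \<le> y" "y \<le> x"
  shows "x ^ Suc n - y ^ Suc n \<le> real (Suc n) * x ^ n * (x - y)"
proof (induction n)
  case (Suc n)
  have "x ^ Suc (Suc n) - y ^ Suc (Suc n) = x * (x ^ Suc n - y ^ Suc n) + y ^ Suc n * (x - y)"
    by (simp add: algebra_simps)
  also have "\<dots> \<le> x * (real (Suc n) * x ^ n * (x - y)) + x ^ Suc n * (x - y)"
    using assms Suc by (intro add_mono mult_left_mono mult_right_mono power_mono) auto
  also have "\<dots> = real (Suc (Suc n)) * x ^ Suc n * (x - y)" by (simp add: algebra_simps)
  finally show ?case .
qed (use assms in simp)

text \<open>
  The main term of the recurrence is \<open>x\<^sup>p\<close>, whose relative increments grow at most by the factor \<open>p\<close>. The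
  classes outside the base group are only \<open>O(K\<^sub>n)\<close> among about \<open>K\<^sub>n\<^sup>p / p\<close>, which the error
  term absorbs.
\<close>

lemma upper_tail_step:
  assumes p: "p \<ge> 2"
  defines "T \<equiv> \<lambda>n i. 1 - class_count p n i / total_count p n"
  shows "T (Suc n) i \<le> real p * T n i + (real p)\<^sup>2 / total_count p n"
proof -
  let ?K = "total_count p n" and ?a = "class_count p n i"
  have K1: "1 \<le> ?K" and a1: "1 \<le> ?a" and aK: "?a \<le> ?K"
    using class_count_ge_1[OF p] class_count_le_total[OF p] by auto
  obtain q where q: "p = Suc q" "q \<ge> 1" using p by (cases p) auto
  define M where "M = ?K ^ q + ((real p)\<^sup>2 - 1)"
  have KM: "total_count p (Suc n) = ?K * M / real p"
    using total_count_Suc[OF p, of n] q by (simp add: M_def algebra_simps)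
  have p2: "(real p)\<^sup>2 - 1 > 0" "real p \<ge> 2" using p by auto
  have Kq: "?K \<le> ?K ^ q" using self_le_power[OF K1] q by simp
  have M: "M > 0" "?K \<le> M" unfolding M_def using Kq K1 p2 by linarith+
  define t where "t = ?K - ?a"
  have t: "0 \<le> t" unfolding t_def using aK by simp
  have "?K ^ p - ?a ^ p \<le> real p * ?K ^ q * t"
    using power_diff_le[of ?a ?K q] a1 aK q unfolding t_def by simp
  moreover have "(?a ^ p + (real p - 1) * ?a) / real p \<le> class_count p (Suc n) i"
    using p class_count_pos[OF p, of n] by (auto simp: class_count.simps(2) less_imp_le split: nat.splits)
  moreover have "total_count p (Suc n) = (?K ^ p + (real p - 1) * ?K) / real p + (real p - 1) * ?K"
    using p2 total_count_Suc[OF p, of n] by (simp add: field_simps power2_eq_square)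
  ultimately have "real p * (total_count p (Suc n) - class_count p (Suc n) i)
      \<le> real p * ?K ^ q * t + (real p - 1) * t + real p * (real p - 1) * ?K"
    using p2 unfolding t_def by (simp add: field_simps)
  also have "\<dots> \<le> real p * M * t + (real p)\<^sup>2 * ?K"
  proof -
    have "(real p - 1) * t \<le> (real p * ((real p)\<^sup>2 - 1)) * t"
    proof (rule mult_right_mono[OF _ t])
      have "real p - 1 \<le> (real p)\<^sup>2 - 1" using p2 by (simp add: power2_eq_square)
      also have "\<dots> \<le> real p * ((real p)\<^sup>2 - 1)" 
        using mult_right_mono[of 1 "real p" "(real p)\<^sup>2 - 1"] p2 by simp
      finally show "real p - 1 \<le> real p * ((real p)\<^sup>2 - 1)" .
    qed
    moreover have "real p * (real p - 1) * ?K \<le> (real p)\<^sup>2 * ?K"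
      using K1 p2 by (intro mult_right_mono) (auto simp: power2_eq_square)
    ultimately show ?thesis unfolding M_def by (simp add: algebra_simps)
  qed
  finally have main: "real p * (total_count p (Suc n) - class_count p (Suc n) i)
      \<le> real p * M * t + (real p)\<^sup>2 * ?K" .
  have "T (Suc n) i = (real p * (total_count p (Suc n) - class_count p (Suc n) i)) / (?K * M)"
    unfolding T_def KM using M K1 p2 by (simp add: field_simps)
  also have "\<dots> \<le> (real p * M * t + (real p)\<^sup>2 * ?K) / (?K * M)"
    using main M K1 by (intro divide_right_mono) auto
  also have "\<dots> = real p * T n i + (real p)\<^sup>2 / M"
    unfolding T_def t_def using M K1 by (simp add: field_simps)
  also have "(real p)\<^sup>2 / M \<le> (real p)\<^sup>2 / ?K" using M K1 by (intro divide_left_mono) auto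
  finally show ?thesis by simp
qed

text \<open>
  The subtracted 1 in the bound for the induction compensates for the error term of each step.
\<close>

lemma upper_tail:
  assumes p: "p \<ge> 2"
  shows "1 - class_count p n i / total_count p n \<le> (real p)\<^sup>2 * real p ^ n / total_count p i"
proof -
  have "1 - class_count p n i / total_count p n \<le> (real p)\<^sup>2 * (real p ^ n - 1) / total_count p i"
  proof (induction n)
    case (Suc n)
    let ?T = "\<lambda>n. 1 - class_count p n i / total_count p n"
    have Ki: "1 \<le> total_count p i" using class_count_ge_1[OF p] .
    have pn: "1 \<le> real p ^ Suc n" using p by (intro one_le_power) simp
    show ?case
    proof (cases "Suc n \<le> i")
      case True
      then have "class_count p (Suc n) i = total_count p (Suc n)" by (rule class_count_eq_total)
      moreover have "0 < total_count p (Suc n)" using class_count_pos[OF p] .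
      ultimately have "?T (Suc n) = 0" by simp
      then show ?thesis using Ki pn by simp
    next
      case False
      then have "total_count p i \<le> total_count p n" by (intro total_count_mono[OF p]) auto
      then have "(real p)\<^sup>2 / total_count p n \<le> (real p)\<^sup>2 / total_count p i"
        using Ki by (intro divide_left_mono) auto
      then have "?T (Suc n) \<le> real p * ?T n + (real p)\<^sup>2 / total_count p i"
        using upper_tail_step[OF p, of n i] by linarith
      also have "\<dots> \<le> real p * ((real p)\<^sup>2 * (real p ^ n - 1) / total_count p i)
          + (real p)\<^sup>2 / total_count p i"
        using Suc by (intro add_right_mono mult_left_mono) auto
      also have "\<dots> = (real p)\<^sup>2 * (real p * (real p ^ n - 1) + 1) / total_count p i"
        using Ki by (simp add: field_simps)
      also have "\<dots> \<le> (real p)\<^sup>2 * (real p ^ Suc n - 1) / total_count p i"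
        using Ki p by (intro divide_right_mono mult_left_mono) (auto simp: algebra_simps)
      finally show ?thesis .
    qed
  qed simp
  also have "\<dots> \<le> (real p)\<^sup>2 * real p ^ n / total_count p i"
    using class_count_ge_1[OF p, of i i] by (intro divide_right_mono mult_left_mono) auto
  finally show ?thesis .
qed

text \<open>
  The base group of \<open>P\<^bsub>i+2\<^esub>\<close> has exponent \<open>p\<^bsup>i+1\<^esup>\<close>, so all classes of larger order lie outside it.
  Therefore the deficit for \<open>i + 1\<close> is \<open>p - 1\<close> times the deficit for \<open>i\<close>.
\<close>

lemma count_deficit_at_start:
  assumes p: "p \<ge> 2"
  shows "1 \<le> total_count p (Suc i) - class_count p (Suc i) i"
proof (induction i)
  case 0
  show ?case using p by (simp add: class_count.simps(2) field_simps)
next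
  case (Suc i)
  have "total_count p (Suc (Suc i)) - class_count p (Suc (Suc i)) (Suc i)
      = (real p - 1) * (total_count p (Suc i) - class_count p (Suc i) i)"
    unfolding class_count.simps(2)[of p "Suc i"]
    using class_count_eq_total[of "Suc i" "Suc (Suc i)" p]
    by (simp add: algebra_simps)
  also have "1 * 1 \<le> \<dots>" using p Suc by (intro mult_mono) auto
  finally show ?case by simp
qed

text \<open>
  For \<open>f(x) = x\<^sup>p + (p\<^sup>2 - 1) x\<close> the quotient \<open>f(K) / f(a)\<close> exceeds \<open>K / a\<close> by the factor
  \<open>(K\<^bsup>p-1\<^esup> + p\<^sup>2 - 1) / (a\<^bsup>p-1\<^esup> + p\<^sup>2 - 1)\<close>. Because of \<open>a \<ge> 1\<close> the term \<open>a\<^bsup>p-1\<^esup>\<close> is at least the fraction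
  \<open>1 / p\<^sup>2\<close> of the denominator, so the factor is at least \<open>1 + (K / a - 1) / p\<^sup>2\<close>. The true growth rate is close to \<open>p\<close>, but
  any rate above 1 suffices for the tail.
\<close>

lemma lower_tail_step:
  assumes p: "p \<ge> 2"
  defines "v \<equiv> \<lambda>n i. total_count p n / class_count p n i - 1"
  shows "(1 + 1 / (real p)\<^sup>2) * v n i \<le> v (Suc n) i"
proof -
  let ?K = "total_count p n" and ?a = "class_count p n i" and ?c = "(real p)\<^sup>2 - 1"
  have a1: "1 \<le> ?a" and aK: "?a \<le> ?K"
    using class_count_ge_1[OF p] class_count_le_total[OF p] by auto
  obtain q where q: "p = Suc q" "q \<ge> 1" using p by (cases p) auto
  have c: "?c > 0" using p by simp
  define w where "w = v n i"
  have w: "0 \<le> w" "?K = (1 + w) * ?a" unfolding w_def v_def using a1 aK by (auto simp: field_simps)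
  have aq: "1 \<le> ?a ^ q" using a1 by simp
  have "1 + w / (real p)\<^sup>2 \<le> (?K ^ q + ?c) / (?a ^ q + ?c)"
  proof -
    have "(1 + w / (1 + ?c)) * (?a ^ q + ?c) = ?a ^ q + ?c + w * ((?a ^ q + ?c) / (1 + ?c))"
      using c by (simp add: field_simps)
    also have "(?a ^ q + ?c) / (1 + ?c) \<le> ?a ^ q"
    proof -
      have "?c * 1 \<le> ?c * ?a ^ q" using aq c by (intro mult_left_mono) auto
      then have "?a ^ q + ?c \<le> ?a ^ q * (1 + ?c)" by (simp add: algebra_simps)
      moreover have "0 < 1 + ?c" using c by linarith
      ultimately show ?thesis using pos_divide_le_eq by blast
    qed
    then have "?a ^ q + ?c + w * ((?a ^ q + ?c) / (1 + ?c)) \<le> (1 + w) * ?a ^ q + ?c"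
      using w(1) mult_left_mono[of "(?a ^ q + ?c) / (1 + ?c)" "?a ^ q" w] by (simp add: algebra_simps)
    also have "(1 + w) * ?a ^ q \<le> (1 + w) ^ q * ?a ^ q"
      using self_le_power[of "1 + w" q] w q aq by (intro mult_right_mono) auto
    also have "\<dots> = ?K ^ q" using w(2) by (simp add: power_mult_distrib)
    finally show ?thesis using aq c by (simp add: le_divide_eq)
  qed
  then have "(1 + w) * (1 + w / (real p)\<^sup>2) \<le> (1 + w) * ((?K ^ q + ?c) / (?a ^ q + ?c))"
    using w(1) by (intro mult_left_mono) auto
  also have "\<dots> = ?K * (?K ^ q + ?c) / (?a * (?a ^ q + ?c))"
  proof -
    have "1 + w = ?K / ?a" using w(2) a1 by simp
    then show ?thesis by (simp only: times_divide_times_eq)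
  qed
  also have "\<dots> = total_count p (Suc n) / ((?a ^ p + ?c * ?a) / real p)"
  proof -
    have "total_count p (Suc n) = ?K * (?K ^ q + ?c) / real p"
      using total_count_Suc[OF p, of n] q by (simp add: algebra_simps)
    moreover have "(?a ^ p + ?c * ?a) / real p = ?a * (?a ^ q + ?c) / real p"
      using q by (simp add: algebra_simps)
    ultimately show ?thesis using p by simp
  qed
  also have "\<dots> \<le> total_count p (Suc n) / class_count p (Suc n) i"
    using class_count_Suc_le[OF p, of n i] class_count_pos[OF p, of "Suc n"]
    by (intro divide_left_mono mult_pos_pos)
       (auto simp: less_imp_le intro: less_le_trans)
  finally have "(1 + w) * (1 + w / (real p)\<^sup>2) - 1 \<le> v (Suc n) i"
    unfolding v_def by simp
  moreover have "(1 + 1 / (real p)\<^sup>2) * w \<le> (1 + w) * (1 + w / (real p)\<^sup>2) - 1"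
    using w(1) by (simp add: algebra_simps add_divide_distrib)
  ultimately show ?thesis unfolding w_def by linarith
qed

lemma lower_tail:
  assumes p: "p \<ge> 2" and "i < n"
  shows "class_count p n i / total_count p n
    \<le> total_count p (Suc i) * (1 + 1 / (real p)\<^sup>2) ^ Suc i / (1 + 1 / (real p)\<^sup>2) ^ n"
proof -
  let ?r = "1 + 1 / (real p)\<^sup>2"
  define v where "v n = total_count p n / class_count p n i - 1" for n
  have r: "?r > 0" using p by (simp add: add_pos_pos)
  have "1 / total_count p (Suc i) \<le> v (Suc i)"
  proof -
    let ?K = "total_count p (Suc i)" and ?a = "class_count p (Suc i) i"
    have a: "0 < ?a" "?a \<le> ?K" using class_count_pos[OF p] class_count_le_total[OF p] by auto
    then have "1 / ?K \<le> 1 / ?a" by (intro divide_left_mono) auto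
    also have "\<dots> \<le> (?K - ?a) / ?a"
      using count_deficit_at_start[OF p, of i] a by (intro divide_right_mono) auto
    also have "\<dots> = v (Suc i)" unfolding v_def using a by (simp add: diff_divide_distrib)
    finally show ?thesis .
  qed
  then have base: "?r ^ Suc i / (?r ^ Suc i * total_count p (Suc i)) \<le> v (Suc i)"
    using r by simp
  have "?r ^ n / (?r ^ Suc i * total_count p (Suc i)) \<le> v n"
    using Suc_leI[OF assms(2)]
  proof (induction n rule: dec_induct)
    case base
    show ?case by (fact \<open>?r ^ Suc i / (?r ^ Suc i * total_count p (Suc i)) \<le> v (Suc i)\<close>)
  next
    case (step n)
    have "?r ^ Suc n / (?r ^ Suc i * total_count p (Suc i))
        = ?r * (?r ^ n / (?r ^ Suc i * total_count p (Suc i)))" by simp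
    also have "\<dots> \<le> ?r * v n" using step r by (intro mult_left_mono) auto
    also have "\<dots> \<le> v (Suc n)" using lower_tail_step[OF p, of n i] unfolding v_def .
    finally show ?case .
  qed
  moreover have "v n \<le> total_count p n / class_count p n i" unfolding v_def by simp
  ultimately have *: "?r ^ n / (?r ^ Suc i * total_count p (Suc i)) \<le> total_count p n / class_count p n i"
    by linarith
  have pos: "0 < ?r ^ n / (?r ^ Suc i * total_count p (Suc i))"
    using r class_count_pos[OF p, of "Suc i" "Suc i"] by simp
  have "inverse (total_count p n / class_count p n i) \<le> inverse (?r ^ n / (?r ^ Suc i * total_count p (Suc i)))"
    using le_imp_inverse_le[OF * pos] .
  then show ?thesis by (simp add: mult.commute del: power_Suc)
qed

lemma poly_times_geometric_bounded:
  fixes x :: real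
  assumes "0 \<le> x" "x < 1" "k > 0"
  shows "\<exists>C\<ge>0. \<forall>n. real n ^ k * x ^ n \<le> C"
proof -
  define y where "y = root k x"
  have y: "y ^ k = x" "0 \<le> y" unfolding y_def using assms by auto
  have "y < 1" unfolding y_def using assms by (simp add: real_root_lt_1_iff)
  then have "(\<lambda>n. of_nat n * y ^ n) \<longlonglongrightarrow> 0" using y by (intro powser_times_n_limit_0) simp
  then have "Bseq (\<lambda>n. real n * y ^ n)" by (intro convergent_imp_Bseq convergentI)
  then obtain C where C: "C > 0" "\<And>n. norm (real n * y ^ n) \<le> C" unfolding Bseq_def by blast
  have "real n ^ k * x ^ n \<le> C ^ k" for n
  proof -
    have "real n ^ k * x ^ n = (real n * y ^ n) ^ k"
      by (simp add: power_mult_distrib flip: y(1) power_mult) (simp add: mult.commute)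
    also have "\<dots> \<le> C ^ k" using C(2)[of n] y(2) by (intro power_mono) auto
    finally show ?thesis .
  qed
  then show ?thesis using C(1) by (intro exI[of _ "C ^ k"]) auto
qed


text \<open>
  With \<open>h\<^sup>2 = 1 + 1 / p\<^sup>2\<close> choose \<open>e\<close> such that \<open>p \<le> h\<close> raised to \<open>p\<^sup>e\<close>. Then
  \<open>K\<^bsub>i+1\<^esub> \<le> h\<^sup>n\<close> as soon as \<open>i + 1 + e \<le> m\<close>, which uses up only half of the decay \<open>h\<^bsup>-2n\<^esup>\<close> in the lower tail.
  The remaining \<open>h\<^bsup>-n\<^esup>\<close> beats the polynomial factors.
\<close>

lemma lower_deviation_bounded:
  assumes p: "p \<ge> 2"
  shows "\<exists>e C. 0 \<le> C \<and> (\<forall>n m i. p ^ m \<le> n \<longrightarrow> i + 1 + e \<le> m \<longrightarrow>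
    (real m)\<^sup>2 * (class_count p n i / total_count p n) \<le> C)"
proof -
  define h where "h = sqrt (1 + 1 / (real p)\<^sup>2)"
  have r: "1 + 1 / (real p)\<^sup>2 = h\<^sup>2" unfolding h_def by simp
  have h1: "1 < h" unfolding h_def using p by simp
  have "1 / (real p)\<^sup>2 \<le> 1" using p by (simp add: divide_le_eq)
  then have h2: "h\<^sup>2 \<le> 2" using r by linarith
  obtain e where e: "real p < h ^ e" using real_arch_pow[OF h1] by blast
  have "e \<le> p ^ e" using p by (metis less_exp less_imp_le order_trans power_mono zero_le)
  then have pe: "real p \<le> h ^ (p ^ e)"
    using e h1 power_increasing[of e "p ^ e" h] by linarith
  have "0 \<le> 1 / h" "1 / h < 1" using h1 by auto
  then obtain C where C: "0 \<le> C" "\<And>n. real n ^ 3 * (1 / h) ^ n \<le> C"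
    using poly_times_geometric_bounded[of "1 / h" 3] by auto
  have "(real m)\<^sup>2 * (class_count p n i / total_count p n) \<le> C"
    if mn: "p ^ m \<le> n" and im: "i + 1 + e \<le> m" for n m i
  proof -
    have mn': "2 ^ m \<le> n" using p mn by (metis order_trans power_mono zero_le)
    then have m_n: "m < n" using less_exp[of m] by linarith
    have Ki: "total_count p (Suc i) \<le> h ^ n"
    proof -
      have "total_count p (Suc i) \<le> real p ^ (p ^ Suc i)" using total_count_upper[OF p] .
      also have "\<dots> \<le> (h ^ (p ^ e)) ^ (p ^ Suc i)" using pe by (intro power_mono) auto
      also have "\<dots> = h ^ (p ^ (e + Suc i))" by (simp only: power_mult[symmetric] power_add[symmetric])
      also have "\<dots> \<le> h ^ n"
      proof (intro power_increasing)
        have "p ^ (e + Suc i) \<le> p ^ m" using p im by (intro power_increasing) auto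
        with mn show "p ^ (e + Suc i) \<le> n" by linarith
      qed (use h1 in auto)
      finally show ?thesis .
    qed
    have "(h\<^sup>2) ^ Suc i \<le> 2 ^ Suc i" using h2 by (intro power_mono) auto
    also have "(2::real) ^ Suc i \<le> 2 ^ m" using im by (intro power_increasing) auto
    also have "\<dots> \<le> real n" using mn' by (metis of_nat_le_iff of_nat_numeral of_nat_power)
    finally have hi: "(h\<^sup>2) ^ Suc i \<le> real n" .
    have "class_count p n i / total_count p n \<le> total_count p (Suc i) * (h\<^sup>2) ^ Suc i / (h\<^sup>2) ^ n"
      using lower_tail[OF p, of i n] m_n im unfolding r by simp
    also have "\<dots> \<le> h ^ n * real n / (h\<^sup>2) ^ n"
      using Ki hi h1 by (intro divide_right_mono mult_mono) auto
    also have "\<dots> = real n * (1 / h) ^ n"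
      using h1 by (simp add: power2_eq_square power_mult_distrib field_simps)
    finally have q: "class_count p n i / total_count p n \<le> real n * (1 / h) ^ n" .
    have "(real m)\<^sup>2 * (class_count p n i / total_count p n) \<le> (real n)\<^sup>2 * (real n * (1 / h) ^ n)"
      using m_n q class_count_pos[OF p, of n] by (intro mult_mono power_mono) (auto simp: less_imp_le)
    also have "\<dots> = real n ^ 3 * (1 / h) ^ n" by (simp add: power2_eq_square power3_eq_cube)
    also have "\<dots> \<le> C" by (rule C)
    finally show ?thesis .
  qed
  with C(1) show ?thesis by blast
qed

text \<open>
  The shift 5 is what makes \<open>K\<^bsub>m+5\<^esub> \<ge> p\<^bsup>2n\<^esup>\<close> follow from the lower bound for \<open>K\<close> and
  \<open>n < p\<^bsup>m+1\<^esup>\<close>.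
\<close>

lemma upper_deviation_bounded:
  assumes p: "p \<ge> 2"
  shows "\<exists>C\<ge>0. \<forall>n m. n < p ^ Suc m \<longrightarrow>
    (real n)\<^sup>2 * (1 - class_count p n (m + 5) / total_count p n) \<le> C"
proof -
  have "0 \<le> 1 / real p" "1 / real p < 1" using p by auto
  then obtain C where C: "0 \<le> C" "\<And>n. (real n)\<^sup>2 * (1 / real p) ^ n \<le> C"
    using poly_times_geometric_bounded[of "1 / real p" 2] by auto
  have "(real n)\<^sup>2 * (1 - class_count p n (m + 5) / total_count p n) \<le> (real p)\<^sup>2 * C"
    if mn: "n < p ^ Suc m" for n m
  proof -
    let ?K = "total_count p (m + 5)"
    have "real p ^ (2 * n) \<le> (2 ^ p) ^ (2 * n)"
    proof (intro power_mono)
      have "p \<le> 2 ^ p" using less_exp[of p] by linarith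
      then show "real p \<le> 2 ^ p" by (metis of_nat_le_iff of_nat_numeral of_nat_power)
    qed simp
    also have "\<dots> = 2 ^ (p * 2 * n)" by (simp add: mult.assoc flip: power_mult)
    also have "\<dots> \<le> 2 ^ (p ^ (m + 3))"
    proof (intro power_increasing)
      have "p * 2 * n \<le> p * p * p ^ Suc m" using p mn by (intro mult_mono) auto
      also have "\<dots> = p ^ (m + 3)" by (simp add: numeral_3_eq_3)
      finally show "p * 2 * n \<le> p ^ (m + 3)" .
    qed simp
    also have "\<dots> \<le> total_count p (m + 3 + 2)" by (rule total_count_lower[OF p])
    also have "m + 3 + 2 = m + 5" by simp
    finally have K: "real p ^ (2 * n) \<le> ?K" .
    have "1 - class_count p n (m + 5) / total_count p n \<le> (real p)\<^sup>2 * real p ^ n / ?K"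
      by (rule upper_tail[OF p])
    also have "\<dots> \<le> (real p)\<^sup>2 * real p ^ n / real p ^ (2 * n)"
      using K p class_count_pos[OF p] by (intro divide_left_mono mult_pos_pos) auto
    also have "\<dots> = (real p)\<^sup>2 * (1 / real p) ^ n"
      unfolding mult_2 power_add using p by (simp add: power_one_over)
    finally have "(real n)\<^sup>2 * (1 - class_count p n (m + 5) / total_count p n)
        \<le> (real n)\<^sup>2 * ((real p)\<^sup>2 * (1 / real p) ^ n)" by (intro mult_left_mono) auto
    also have "\<dots> = (real p)\<^sup>2 * ((real n)\<^sup>2 * (1 / real p) ^ n)" by (simp add: ac_simps)
    also have "\<dots> \<le> (real p)\<^sup>2 * C" using C(2) by (intro mult_left_mono) auto
    finally show ?thesis .
  qed
  then show ?thesis using C(1) by (intro exI[of _ "(real p)\<^sup>2 * C"]) auto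
qed

text \<open>
  Within distance \<open>s\<close> of \<open>m\<close> the squared deviation is bounded; below it is at most \<open>m\<^sup>2\<close> and above at most
  \<open>n\<^sup>2\<close>, since \<open>f\<close> cannot exceed \<open>n\<close>, and both are outweighed by the tails.
\<close>

lemma second_moment_bounded:
  assumes p: "p \<ge> 2"
  shows "\<exists>C\<ge>0. \<forall>n m X (f :: 'a \<Rightarrow> nat). finite X \<longrightarrow> X \<noteq> {} \<longrightarrow>
    (\<forall>i. real (card {x\<in>X. f x \<le> i}) = class_count p n i) \<longrightarrow> p ^ m \<le> n \<longrightarrow> n < p ^ Suc m \<longrightarrow>
    (\<Sum>x\<in>X. (real (f x) - real m)\<^sup>2) / real (card X) \<le> C"
proof -
  obtain e C1 where C1: "0 \<le> C1" "\<And>n m i. p ^ m \<le> n \<Longrightarrow> i + 1 + e \<le> m \<Longrightarrow>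
      (real m)\<^sup>2 * (class_count p n i / total_count p n) \<le> C1"
    using lower_deviation_bounded[OF p] by blast
  obtain C2 where C2: "0 \<le> C2" "\<And>n m. n < p ^ Suc m \<Longrightarrow>
      (real n)\<^sup>2 * (1 - class_count p n (m + 5) / total_count p n) \<le> C2"
    using upper_deviation_bounded[OF p] by blast
  define s where "s = e + 5"
  have "(\<Sum>x\<in>X. (real (f x) - real m)\<^sup>2) / real (card X) \<le> (real s)\<^sup>2 + C1 + C2"
    if fin: "finite X" and ne: "X \<noteq> {}"
      and count: "\<And>i. real (card {x\<in>X. f x \<le> i}) = class_count p n i"
      and mn: "p ^ m \<le> n" "n < p ^ Suc m" for n m X and f :: "'a \<Rightarrow> nat"
  proof -
    define N where "N = max n (Max (f ` X))"
    have "{x\<in>X. f x \<le> N} = X" unfolding N_def using fin by (auto simp: le_max_iff_disj)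
    then have cX: "real (card X) = total_count p n"
      using count[of N] class_count_eq_total[of n N p] unfolding N_def by simp
    have "card {x\<in>X. f x \<le> n} = card X" using count[of n] cX by simp
    then have "{x\<in>X. f x \<le> n} = X" using fin by (intro card_subset_eq) auto
    then have fn: "f x \<le> n" if "x \<in> X" for x using that by blast
    have m_n: "m \<le> n"
    proof -
      have "m < 2 ^ m" by (rule less_exp)
      also have "(2::nat) ^ m \<le> p ^ m" using p by (intro power_mono) auto
      finally show ?thesis using mn by linarith
    qed
    define L where "L = {x\<in>X. f x + e < m}"
    define U where "U = {x\<in>X. m + 5 < f x}"
    have pt: "(real (f x) - real m)\<^sup>2 \<le> (real s)\<^sup>2
        + (if x \<in> L then (real m)\<^sup>2 else 0) + (if x \<in> U then (real n)\<^sup>2 else 0)" if x: "x \<in> X" for x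
    proof -
      consider "x \<in> L" | "x \<in> U" | "x \<notin> L" "x \<notin> U" by blast
      then show ?thesis
      proof cases
        case 1
        then have "\<bar>real (f x) - real m\<bar> \<le> \<bar>real m\<bar>" unfolding L_def by auto
        then have "(real (f x) - real m)\<^sup>2 \<le> (real m)\<^sup>2" by (simp only: abs_le_square_iff)
        moreover have "(if x \<in> L then (real m)\<^sup>2 else 0) = (real m)\<^sup>2" using 1 by simp
        moreover have "0 \<le> (if x \<in> U then (real n)\<^sup>2 else 0)" by simp
        moreover have "0 \<le> (real s)\<^sup>2" by simp
        ultimately show ?thesis by linarith
      next
        case 2
        then have "\<bar>real (f x) - real m\<bar> \<le> \<bar>real n\<bar>" using fn[OF x] unfolding U_def by auto
        then have "(real (f x) - real m)\<^sup>2 \<le> (real n)\<^sup>2" by (simp only: abs_le_square_iff)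
        moreover have "(if x \<in> U then (real n)\<^sup>2 else 0) = (real n)\<^sup>2" using 2 by simp
        moreover have "0 \<le> (if x \<in> L then (real m)\<^sup>2 else 0)" by simp
        moreover have "0 \<le> (real s)\<^sup>2" by simp
        ultimately show ?thesis by linarith
      next
        case 3
        then have "\<bar>real (f x) - real m\<bar> \<le> \<bar>real s\<bar>" using x unfolding L_def U_def s_def by auto
        then have "(real (f x) - real m)\<^sup>2 \<le> (real s)\<^sup>2" by (simp only: abs_le_square_iff)
        then show ?thesis using 3 by simp
      qed
    qed
    have subs: "L \<subseteq> X" "U \<subseteq> X" unfolding L_def U_def by auto
    have "(\<Sum>x\<in>X. (real (f x) - real m)\<^sup>2) \<le> (\<Sum>x\<in>X. (real s)\<^sup>2
        + (if x \<in> L then (real m)\<^sup>2 else 0) + (if x \<in> U then (real n)\<^sup>2 else 0))"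
      by (intro sum_mono pt)
    also have "\<dots> = real (card X) * (real s)\<^sup>2 + real (card L) * (real m)\<^sup>2 + real (card U) * (real n)\<^sup>2"
      using subs fin by (simp add: sum.distrib sum.If_cases Int_absorb1)
    finally have sum: "(\<Sum>x\<in>X. (real (f x) - real m)\<^sup>2) / real (card X)
        \<le> (real s)\<^sup>2 + (real m)\<^sup>2 * (real (card L) / real (card X)) + (real n)\<^sup>2 * (real (card U) / real (card X))"
      using fin ne by (simp add: field_simps card_gt_0_iff)
    have "(real m)\<^sup>2 * (real (card L) / real (card X)) \<le> C1"
    proof (cases "e < m")
      case True
      have "L = {x\<in>X. f x \<le> m - Suc e}" unfolding L_def using True by auto
      then show ?thesis using C1(2)[OF mn(1), of "m - Suc e"] True count[of "m - Suc e"] cX by simp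
    next
      case False
      then have "L = {}" unfolding L_def by auto
      then show ?thesis using C1(1) by simp
    qed
    moreover have "(real n)\<^sup>2 * (real (card U) / real (card X)) \<le> C2"
    proof -
      have "U = X - {x\<in>X. f x \<le> m + 5}" unfolding U_def by auto
      then have "card U = card X - card {x\<in>X. f x \<le> m + 5}" using fin by (simp add: card_Diff_subset)
      moreover have "card {x\<in>X. f x \<le> m + 5} \<le> card X" using fin by (intro card_mono) auto
      ultimately have "real (card U) = total_count p n - class_count p n (m + 5)"
        using count[of "m + 5"] cX by simp
      then have "real (card U) / real (card X) = 1 - class_count p n (m + 5) / total_count p n"
        using cX class_count_pos[OF p, of n n] by (simp add: diff_divide_distrib)
      then show ?thesis using C2(2)[OF mn(2)] by simp
    qed
    ultimately show ?thesis using sum by linarith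
  qed
  then show ?thesis using C1(1) C2(1) by (intro exI[of _ "(real s)\<^sup>2 + C1 + C2"]) auto
qed

section \<open>Sylow subgroups of symmetric groups\<close>

text \<open>
  Among the factors \<open>1, \<dots>, pm\<close> only the multiples of \<open>p\<close> count, and they are \<open>p\<close> times the factors of
  \<open>m!\<close>.
\<close>

lemma multiplicity_fact_mult:
  fixes p :: nat
  assumes p: "prime p"
  shows "multiplicity p (fact (p * m) :: nat) = m + multiplicity p (fact m :: nat)"
proof (induction m)
  case (Suc m)
  have pm: "prime_elem p" "p > 1" using p prime_gt_1_nat by auto
  have less: "multiplicity p (fact (p * m + r) :: nat) = multiplicity p (fact (p * m) :: nat)" if "r < p" for r
    using that
  proof (induction r)
    case (Suc r)
    have "\<not> p dvd Suc r" using Suc.prems by (auto dest: dvd_imp_le)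
    then have "\<not> p dvd Suc (p * m + r)" by (metis add_Suc_right dvd_add_triv_left_iff dvd_triv_left dvd_add_right_iff)
    then have "multiplicity p (Suc (p * m + r)) = 0" by (rule not_dvd_imp_multiplicity_0)
    moreover have "(fact (p * m + Suc r) :: nat) = Suc (p * m + r) * fact (p * m + r)" by simp
    ultimately show ?case using Suc pm
      by (simp add: prime_elem_multiplicity_mult_distrib del: mult_Suc)
  qed simp
  have "p * Suc m = Suc (p * m + (p - 1))" using pm by simp
  then have "(fact (p * Suc m) :: nat) = (p * Suc m) * fact (p * m + (p - 1))" by (metis fact_Suc of_nat_id)
  then have "multiplicity p (fact (p * Suc m) :: nat) = multiplicity p (p * Suc m) + multiplicity p (fact (p * m) :: nat)"
    using less[of "p - 1"] pm by (simp add: prime_elem_multiplicity_mult_distrib del: mult_Suc_right mult_Suc)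
  also have "\<dots> = 1 + multiplicity p (Suc m) + (m + multiplicity p (fact m :: nat))"
    using Suc pm by (simp add: prime_elem_multiplicity_mult_distrib del: mult_Suc_right mult_Suc)
  also have "multiplicity p (fact (Suc m) :: nat) = multiplicity p (Suc m) + multiplicity p (fact m :: nat)"
    using pm by (simp add: prime_elem_multiplicity_mult_distrib del: mult_Suc)
  ultimately show ?case by simp
qed simp

text \<open>
  This matches the order \<open>p |G|\<^sup>p\<close> of the wreath product, so that the wreath product of a Sylow subgroup is again
  a Sylow subgroup.
\<close>

lemma multiplicity_fact_prime_power:
  fixes p :: nat
  assumes p: "prime p"
  shows "multiplicity p (fact (p ^ Suc n) :: nat) = Suc (p * multiplicity p (fact (p ^ n) :: nat))"
proof -
  have *: "multiplicity p (fact (p ^ Suc n) :: nat) = p ^ n + multiplicity p (fact (p ^ n) :: nat)" for n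
    using multiplicity_fact_mult[OF p, of "p ^ n"] by simp
  show ?thesis
  proof (induction n)
    case 0
    then show ?case using *[of 0] by simp
  next
    case (Suc n)
    have "multiplicity p (fact (p ^ Suc (Suc n)) :: nat)
        = p * p ^ n + Suc (p * multiplicity p (fact (p ^ n) :: nat))"
      unfolding *[of "Suc n"] Suc by simp
    also have "\<dots> = Suc (p * (p ^ n + multiplicity p (fact (p ^ n) :: nat)))" by (simp add: algebra_simps)
    finally show ?case unfolding *[of n] .
  qed
qed

text \<open>
  The imprimitive action of the wreath product: point \<open>Nb + j\<close> with \<open>1 \<le> j \<le> N\<close> is point \<open>j\<close> of block \<open>b\<close>. The shifts by 1 are
  there because the symmetric group acts on \<open>{1..n}\<close>.
\<close>

definition block_perm :: "nat \<Rightarrow> nat \<Rightarrow> nat \<times> (nat \<Rightarrow> nat \<Rightarrow> nat) \<Rightarrow> nat \<Rightarrow> nat" where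
  "block_perm N p u x = (if x \<in> {1..p * N}
     then N * (((x - 1) div N + fst u) mod p) + snd u ((x - 1) div N) ((x - 1) mod N + 1) else x)"

lemma block_perm_in:
  assumes b: "b < p" and j: "j \<in> {1..N}"
  shows "block_perm N p u (N * b + j) = N * ((b + fst u) mod p) + snd u b j"
    and "N * b + j \<in> {1..p * N}"
proof -
  have "N * b + j \<le> N * Suc b" using j by simp
  also have "\<dots> \<le> N * p" using b by (intro mult_le_mono2) simp
  finally show *: "N * b + j \<in> {1..p * N}" using j by (simp add: mult.commute)
  obtain i where i: "j = Suc i" "i < N" using j by (cases j) auto
  have "(N * b + j - 1) div N = b" "(N * b + j - 1) mod N + 1 = j"
    unfolding i(1) using i(2) by simp_all
  then show "block_perm N p u (N * b + j) = N * ((b + fst u) mod p) + snd u b j"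
    using * unfolding block_perm_def by simp
qed

lemma block_coordinates:
  fixes N p x :: nat
  assumes x: "x \<in> {1..p * N}"
  obtains b j where "b < p" "j \<in> {1..N}" "x = N * b + j"
proof
  have N: "0 < N" using x by (cases N) auto
  show "(x - 1) div N < p" using x by (simp add: div_less_iff_less_mult N mult.commute) linarith
  show "(x - 1) mod N + 1 \<in> {1..N}" using mod_less_divisor[OF N, of "x - 1"] by auto
  show "x = N * ((x - 1) div N) + ((x - 1) mod N + 1)" using x by simp
qed

lemma block_coordinates_inject:
  fixes N :: nat
  assumes "N * b + j = N * c + l" "j \<in> {1..N}" "l \<in> {1..N}"
  shows "b = c" "j = l"
proof -
  have "N * b + (j - 1) = N * c + (l - 1)" "j - 1 < N" "l - 1 < N" using assms by auto
  then have "(N * b + (j - 1)) div N = (N * c + (l - 1)) div N" by simp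
  then show "b = c" using \<open>j - 1 < N\<close> \<open>l - 1 < N\<close> by simp
  then show "j = l" using assms by simp
qed

lemma block_perm_out: "x \<notin> {1..p * N} \<Longrightarrow> block_perm N p u x = x"
  by (simp only: block_perm_def if_False)

lemma wreath_embeds_in_sym_group:
  assumes p: "p > 0" and N: "N > 0" and H: "subgroup H (sym_group N)"
  defines "Wr \<equiv> wreath p (sym_group N\<lparr>carrier := H\<rparr>)"
  shows "block_perm N p \<in> hom Wr (sym_group (p * N))"
    and "inj_on (block_perm N p) (carrier Wr)"
proof -
  have grH: "group (sym_group N\<lparr>carrier := H\<rparr>)"
    using H sym_group_is_group by (rule subgroup.subgroup_is_group)
  interpret W: group Wr unfolding Wr_def using group.group_wreath[OF grH p] .
  have perm: "g b permutes {1..N}" if "(k, g) \<in> carrier Wr" "b < p" for k g b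
  proof -
    have g: "g \<in> {..<p} \<rightarrow>\<^sub>E H" using that(1) unfolding Wr_def carrier_wreath by simp
    have "g b \<in> H" using PiE_mem[OF g, of b] that(2) by simp
    then have "g b \<in> carrier (sym_group N)" by (rule subgroup.mem_carrier[OF H])
    then show ?thesis unfolding sym_group_carrier .
  qed
  have img: "g b j \<in> {1..N}" if "(k, g) \<in> carrier Wr" "b < p" "j \<in> {1..N}" for k g b j
    using perm[OF that(1,2)] that(3) by (simp only: permutes_in_image)
  have mult: "block_perm N p (u \<otimes>\<^bsub>Wr\<^esub> v) = block_perm N p u \<circ> block_perm N p v"
    if u: "u \<in> carrier Wr" and v: "v \<in> carrier Wr" for u v
  proof
    fix x
    obtain k g l h where e: "u = (k, g)" "v = (l, h)" by (metis surj_pair)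
    show "block_perm N p (u \<otimes>\<^bsub>Wr\<^esub> v) x = (block_perm N p u \<circ> block_perm N p v) x"
    proof (cases "x \<in> {1..p * N}")
      case True
      then obtain b j where bj: "b < p" "j \<in> {1..N}" "x = N * b + j" by (rule block_coordinates)
      have c: "(b + l) mod p < p" using p by simp
      have "block_perm N p (u \<otimes>\<^bsub>Wr\<^esub> v) x
          = N * ((b + (k + l) mod p) mod p) + (g ((b + l) mod p) \<circ> h b) j"
        unfolding bj(3) block_perm_in(1)[OF bj(1,2)] e Wr_def mult_wreath
        using bj(1) by (simp add: sym_group_mult)
      also have "(b + (k + l) mod p) mod p = ((b + l) mod p + k) mod p"
        by (metis add.assoc add.commute mod_add_left_eq mod_add_right_eq)
      also have "N * (((b + l) mod p + k) mod p) + (g ((b + l) mod p) \<circ> h b) j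
          = block_perm N p u (block_perm N p v x)"
        unfolding bj(3) block_perm_in(1)[OF bj(1,2)] e fst_conv snd_conv
          block_perm_in(1)[OF c img[OF v[unfolded e] bj(1,2)]] by simp
      finally show ?thesis by simp
    next
      case False
      show ?thesis unfolding o_apply block_perm_out[OF False] ..
    qed
  qed
  have one: "block_perm N p \<one>\<^bsub>Wr\<^esub> = id"
  proof
    fix x
    show "block_perm N p \<one>\<^bsub>Wr\<^esub> x = id x"
    proof (cases "x \<in> {1..p * N}")
      case True
      then obtain b j where bj: "b < p" "j \<in> {1..N}" "x = N * b + j" by (rule block_coordinates)
      show ?thesis unfolding bj(3) block_perm_in(1)[OF bj(1,2)] Wr_def one_wreath
        using bj(1) by (simp add: sym_group_one)
    next
      case False
      show ?thesis unfolding id_apply block_perm_out[OF False] ..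
    qed
  qed
  have permutes: "block_perm N p u permutes {1..p * N}" if u: "u \<in> carrier Wr" for u
  proof -
    have "block_perm N p u \<circ> block_perm N p (inv\<^bsub>Wr\<^esub> u) = id"
      "block_perm N p (inv\<^bsub>Wr\<^esub> u) \<circ> block_perm N p u = id"
      using mult[OF u W.inv_closed[OF u]] mult[OF W.inv_closed[OF u] u] one W.r_inv[OF u] W.l_inv[OF u] by simp_all
    then have "bij (block_perm N p u)" by (metis o_bij)
    then show ?thesis unfolding permutes_def bij_iff using block_perm_out by blast
  qed
  show "block_perm N p \<in> hom Wr (sym_group (p * N))"
    using mult permutes by (simp add: hom_def sym_group_carrier sym_group_mult)
  show "inj_on (block_perm N p) (carrier Wr)"
  proof (rule inj_onI)
    fix u v assume u: "u \<in> carrier Wr" and v: "v \<in> carrier Wr" and eq: "block_perm N p u = block_perm N p v"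
    obtain k g l h where e: "u = (k, g)" "v = (l, h)" by (metis surj_pair)
    have uv: "(k, g) \<in> carrier Wr" "(l, h) \<in> carrier Wr" using u v e by simp_all
    have kl: "k < p" "l < p" and PiE: "g \<in> {..<p} \<rightarrow>\<^sub>E H" "h \<in> {..<p} \<rightarrow>\<^sub>E H"
      using uv unfolding Wr_def carrier_wreath by simp_all
    have coord: "(b + k) mod p = (b + l) mod p" "g b j = h b j" if b: "b < p" and j: "j \<in> {1..N}" for b j
    proof -
      have "N * ((b + k) mod p) + g b j = N * ((b + l) mod p) + h b j"
        using block_perm_in(1)[OF b j, of u] block_perm_in(1)[OF b j, of v] eq unfolding e by simp
      then show "(b + k) mod p = (b + l) mod p" "g b j = h b j"
        using block_coordinates_inject img[OF uv(1) b j] img[OF uv(2) b j] by blast+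
    qed
    have "k = l" using coord(1)[of 0 1] p N kl by simp
    moreover have "g = h"
    proof (rule PiE_ext[OF PiE])
      fix b assume "b \<in> {..<p}"
      then have b: "b < p" by simp
      show "g b = h b"
      proof
        fix j show "g b j = h b j"
          using coord(2)[OF b] permutes_not_in[OF perm[OF uv(1) b]] permutes_not_in[OF perm[OF uv(2) b]]
          by (cases "j \<in> {1..N}") simp_all
      qed
    qed
    ultimately show "u = v" using e by simp
  qed
qed

lemma order_sym_subgroup: "order (sym_group N\<lparr>carrier := H\<rparr>) = card H"
  by (simp add: order_def)

lemma finite_sym_group: "finite (carrier (sym_group N))"
  unfolding sym_group_def by (simp add: finite_permutations)

lemma sylow_subgroup_sym_group_iff: "sylow_subgroup p (sym_group N) H \<longleftrightarrow>
    subgroup H (sym_group N) \<and> card H = p ^ multiplicity p (fact N :: nat)"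
  unfolding sylow_subgroup_def order_def sym_group_card_carrier by simp

text \<open>
  The embedded wreath product has the order of a Sylow subgroup, and dividing \<open>comm_count_wreath\<close> by \<open>p |G|\<^sup>p\<close> is
  the recurrence for \<open>class_count\<close>. For \<open>i = 0\<close> the prime \<open>p\<close> does not divide \<open>p\<^sup>0\<close>, so the last summand is
  absent on both sides.
\<close>

lemma sylow_wreath_step:
  assumes p: "prime p" and H: "sylow_subgroup p (sym_group (p ^ n)) H"
    and count: "\<And>i. real (comm_count (sym_group (p ^ n)\<lparr>carrier := H\<rparr>) (p ^ i)) = real (card H) * class_count p n i"
  shows "\<exists>Q. sylow_subgroup p (sym_group (p ^ Suc n)) Q \<and>
    (\<forall>i. real (comm_count (sym_group (p ^ Suc n)\<lparr>carrier := Q\<rparr>) (p ^ i)) = real (card Q) * class_count p (Suc n) i)"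
proof -
  let ?S = "sym_group (p ^ n)" and ?T = "sym_group (p * p ^ n)"
  define P where "P = ?S\<lparr>carrier := H\<rparr>"
  have sub: "subgroup H ?S" and cH: "card H = p ^ multiplicity p (fact (p ^ n) :: nat)"
    using H unfolding sylow_subgroup_sym_group_iff by auto
  have p0: "p > 0" "p \<ge> 2" using prime_gt_0_nat[OF p] prime_ge_2_nat[OF p] by auto
  have N: "p ^ n > 0" using p0 by simp
  have ordP: "order P = card H" unfolding P_def by (rule order_sym_subgroup)
  have "group P" unfolding P_def using sub sym_group_is_group by (rule subgroup.subgroup_is_group)
  moreover have "finite (carrier P)"
    unfolding P_def using finite_subset[OF subgroup.subset[OF sub] finite_sym_group] by simp
  ultimately interpret P: prime_wreath P p
    using p ordP cH by (intro prime_wreath.intro prime_wreath_axioms.intro) auto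
  define Q where "Q = block_perm (p ^ n) p ` carrier (wreath p P)"
  have hom: "block_perm (p ^ n) p \<in> hom (wreath p P) ?T"
    and inj: "inj_on (block_perm (p ^ n) p) (carrier (wreath p P))"
    using wreath_embeds_in_sym_group[OF p0(1) N sub] unfolding P_def by auto
  interpret h: group_hom "wreath p P" ?T "block_perm (p ^ n) p"
    using hom P.W.group_axioms sym_group_is_group by (simp add: group_hom_def group_hom_axioms_def)
  have subQ: "subgroup Q ?T" unfolding Q_def by (rule h.img_is_subgroup)
  have cQ: "card Q = p * card H ^ p"
    unfolding Q_def using card_image[OF inj] order_wreath[of p P] ordP by (simp add: order_def)
  then have "card Q = p ^ Suc (p * multiplicity p (fact (p ^ n) :: nat))"
    unfolding cH by (simp add: mult.commute flip: power_mult)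
  then have sylow: "sylow_subgroup p (sym_group (p ^ Suc n)) Q"
    using subQ unfolding sylow_subgroup_sym_group_iff multiplicity_fact_prime_power[OF p] by simp
  have iso: "block_perm (p ^ n) p \<in> iso (wreath p P) (?T\<lparr>carrier := Q\<rparr>)"
    using hom inj unfolding Q_def by (auto simp: iso_def hom_def bij_betw_def)
  have "real (comm_count (sym_group (p ^ Suc n)\<lparr>carrier := Q\<rparr>) (p ^ i)) = real (card Q) * class_count p (Suc n) i" for i
  proof -
    let ?o = "real (card H)"
    have cP: "real (comm_count P (p ^ i)) = ?o * class_count p n i" for i using count unfolding P_def .
    have oo: "?o ^ (p - 1) * ?o = ?o ^ p" using p0 by (simp flip: power_Suc2)
    have pm: "real (p - Suc 0) = real p - 1" using p0 by simp
    define B where "B = real p * (real p - 1) * (case i of 0 \<Rightarrow> 0 | Suc j \<Rightarrow> class_count p n j)"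
    have "comm_count (sym_group (p ^ Suc n)\<lparr>carrier := Q\<rparr>) (p ^ i) = comm_count (wreath p P) (p ^ i)"
      using comm_count_iso[OF P.W.group_axioms _ iso] subgroup.subgroup_is_group[OF subQ sym_group_is_group]
      by simp
    also have "real \<dots> = (?o * class_count p n i) ^ p + (real p - 1) * ?o ^ (p - 1) * (?o * class_count p n i)
        + (if p dvd p ^ i then (real p - 1) * ?o ^ (p - 1) * (real p * real (comm_count P (p ^ i div p))) else 0)"
      unfolding P.comm_count_wreath ordP by (simp add: cP pm)
    also have "(if p dvd p ^ i then (real p - 1) * ?o ^ (p - 1) * (real p * real (comm_count P (p ^ i div p))) else 0)
        = ?o ^ p * B"
    proof (cases i)
      case 0
      then show ?thesis using p0 unfolding B_def by simp
    next
      case (Suc j)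
      have "p ^ i div p = p ^ j" "p dvd p ^ i" using Suc p0 by simp_all
      show ?thesis unfolding B_def Suc oo[symmetric] by (simp add: cP)
    qed
    also have "(?o * class_count p n i) ^ p + (real p - 1) * ?o ^ (p - 1) * (?o * class_count p n i) + ?o ^ p * B
        = ?o ^ p * (class_count p n i ^ p + (real p - 1) * class_count p n i + B)"
      by (simp add: power_mult_distrib oo[symmetric] algebra_simps)
    also have "\<dots> = real (card Q) * class_count p (Suc n) i"
      unfolding cQ class_count.simps(2) B_def using p0 by (simp add: field_simps split: nat.split)
    finally show ?thesis .
  qed
  then show ?thesis by (intro exI[of _ Q] conjI allI sylow)
qed

lemma sylow_exists_with_count:
  assumes p: "prime p"
  shows "\<exists>H. sylow_subgroup p (sym_group (p ^ n)) H \<and>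
    (\<forall>i. real (comm_count (sym_group (p ^ n)\<lparr>carrier := H\<rparr>) (p ^ i)) = real (card H) * class_count p n i)"
proof (induction n)
  case 0
  define M where "M = sym_group 1\<lparr>carrier := {id}\<rparr>"
  have "carrier (sym_group 1) = {id}" unfolding sym_group_def by simp
  then have "subgroup {id} (sym_group 1)" using group.subgroup_self[OF sym_group_is_group] by metis
  then have syl: "sylow_subgroup p (sym_group (p ^ 0)) {id}" and M: "group M"
    unfolding sylow_subgroup_sym_group_iff M_def using subgroup.subgroup_is_group sym_group_is_group by auto
  have cM: "carrier M = {id}" and oM: "\<one>\<^bsub>M\<^esub> = id" unfolding M_def by (simp_all add: sym_group_one)
  have "comm_count M (p ^ i) = 1" for i
  proof -
    have pow: "id [^]\<^bsub>M\<^esub> (p ^ i) = \<one>\<^bsub>M\<^esub>"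
      using monoid.nat_pow_one[OF group.is_monoid[OF M], of "p ^ i"] unfolding oM .
    have "{(x, y). x \<in> carrier M \<and> y \<in> carrier M \<and>
       x \<otimes>\<^bsub>M\<^esub> y = y \<otimes>\<^bsub>M\<^esub> x \<and> x [^]\<^bsub>M\<^esub> (p ^ i) = \<one>\<^bsub>M\<^esub>} = {(id, id)}"
    proof (intro equalityI subsetI)
      fix z assume "z \<in> {(x, y). x \<in> carrier M \<and> y \<in> carrier M \<and>
        x \<otimes>\<^bsub>M\<^esub> y = y \<otimes>\<^bsub>M\<^esub> x \<and> x [^]\<^bsub>M\<^esub> (p ^ i) = \<one>\<^bsub>M\<^esub>}"
      then obtain x y where "z = (x, y)" "x \<in> carrier M" "y \<in> carrier M" by blast
      then show "z \<in> {(id, id)}" unfolding cM by simp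
    next
      fix z :: "(nat \<Rightarrow> nat) \<times> (nat \<Rightarrow> nat)" assume "z \<in> {(id, id)}"
      then have "z = (id, id)" by simp
      then show "z \<in> {(x, y). x \<in> carrier M \<and> y \<in> carrier M \<and>
          x \<otimes>\<^bsub>M\<^esub> y = y \<otimes>\<^bsub>M\<^esub> x \<and> x [^]\<^bsub>M\<^esub> (p ^ i) = \<one>\<^bsub>M\<^esub>}"
        using pow cM by blast
    qed
    then show ?thesis unfolding comm_count_def by simp
  qed
  then have "\<forall>i. real (comm_count (sym_group (p ^ 0)\<lparr>carrier := {id}\<rparr>) (p ^ i)) = real (card {id}) * class_count p 0 i"
    unfolding M_def by simp
  then show ?case by (intro exI[of _ "{id}"] conjI syl)
next
  case (Suc n)
  then obtain H where H: "sylow_subgroup p (sym_group (p ^ n)) H"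
    and count: "\<forall>i. real (comm_count (sym_group (p ^ n)\<lparr>carrier := H\<rparr>) (p ^ i)) = real (card H) * class_count p n i"
    by (elim exE conjE)
  show ?case by (rule sylow_wreath_step[OF p H count[rule_format]])
qed

lemma card_classes_sylow:
  assumes p: "prime p" and H: "sylow_subgroup p (sym_group (p ^ n)) H"
  defines "P \<equiv> sym_group (p ^ n)\<lparr>carrier := H\<rparr>"
  shows "real (card {C \<in> conj_classes P. class_ord P C dvd p ^ i}) = class_count p n i"
proof -
  obtain Q where Q: "sylow_subgroup p (sym_group (p ^ n)) Q"
    and count: "\<forall>i. real (comm_count (sym_group (p ^ n)\<lparr>carrier := Q\<rparr>) (p ^ i)) = real (card Q) * class_count p n i"
    using sylow_exists_with_count[OF p, of n] by (elim exE conjE)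
  interpret S: group "sym_group (p ^ n)" by (rule sym_group_is_group)
  have sub: "subgroup H (sym_group (p ^ n))" "subgroup Q (sym_group (p ^ n))" and card: "card Q = card H"
    using H Q unfolding sylow_subgroup_def by auto
  interpret P: group P unfolding P_def using S.subgroup_imp_group[OF sub(1)] .
  obtain \<psi> where "\<psi> \<in> iso (sym_group (p ^ n)\<lparr>carrier := Q\<rparr>) P"
    using S.sylow_subgroups_isomorphic[OF p finite_sym_group H Q] unfolding P_def by blast
  then have "comm_count (sym_group (p ^ n)\<lparr>carrier := Q\<rparr>) (p ^ i) = comm_count P (p ^ i)"
    using comm_count_iso[OF S.subgroup_imp_group[OF sub(2)] P.group_axioms] by blast
  moreover have "order P = card H" unfolding P_def by (rule order_sym_subgroup)
  moreover have finP: "finite (carrier P)"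
    unfolding P_def using finite_subset[OF subgroup.subset[OF sub(1)] finite_sym_group] by simp
  ultimately have "real (card H) * real (card {C \<in> conj_classes P. class_ord P C dvd p ^ i})
      = real (card H) * class_count p n i"
    using count[rule_format, of i] P.comm_count_eq_card_classes[OF finP, of "p ^ i"] card by simp
  moreover have "card H > 0" using H p prime_gt_0_nat[OF p] unfolding sylow_subgroup_sym_group_iff by simp
  ultimately show ?thesis by simp
qed


section \<open>Mean and variance\<close>

lemma (in group) class_ord_prime_power:
  assumes p: "prime p" and "order G = p ^ e" and C: "C \<in> conj_classes G"
  shows "class_ord G C = p ^ multiplicity p (class_ord G C)"
proof -
  obtain h where h: "h \<in> carrier G" "C = {g \<otimes> h \<otimes> inv g | g. g \<in> carrier G}" using C by (rule conj_classE)
  have "h \<in> C" unfolding h(2) using h(1) by (intro CollectI exI[of _ \<one>]) simp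
  then have "class_ord G C = ord h" using class_ord_eq[OF C] by simp
  then have "class_ord G C dvd p ^ e" using ord_dvd_group_order[OF h(1)] assms(2) by simp
  then obtain k where "class_ord G C = p ^ k" using p by (auto simp: divides_primepow_nat)
  then show ?thesis using p by simp
qed

lemma floor_log_close:
  assumes p: "p \<ge> 2" and "p ^ m \<le> n" "n < p ^ Suc m"
  shows "\<bar>real m - ln (real n) / ln (real p)\<bar> \<le> 1"
proof -
  have lp: "0 < ln (real p)" using p by simp
  have n: "0 < n" using assms p by (metis gr0I le_zero_eq power_eq_0_iff not_numeral_le_zero)
  have "real p ^ m \<le> real n" "real n \<le> real p ^ Suc m"
    using assms by (metis of_nat_le_iff of_nat_power, metis less_imp_le of_nat_le_iff of_nat_power)
  then have "ln (real p ^ m) \<le> ln (real n)" "ln (real n) \<le> ln (real p ^ Suc m)"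
    using n p by (simp_all del: power_Suc)
  then have "real m * ln (real p) \<le> ln (real n)" "ln (real n) \<le> real (Suc m) * ln (real p)"
    using p by (simp_all add: ln_realpow del: power_Suc of_nat_Suc)
  then have "real m \<le> ln (real n) / ln (real p)" "ln (real n) / ln (real p) \<le> real (Suc m)"
    using lp by (simp_all add: pos_le_divide_eq pos_divide_le_eq)
  then show ?thesis by simp
qed

text \<open>
  The second moment about \<open>c\<close> is the variance plus the squared distance of the mean from \<open>c\<close>.
\<close>

lemma mean_variance_from_second_moment:
  fixes f :: "'a \<Rightarrow> real"
  assumes X: "finite X" "X \<noteq> {}" and bound: "(\<Sum>x\<in>X. (f x - c)\<^sup>2) / real (card X) \<le> C"
  shows "\<bar>measure_pmf.expectation (pmf_of_set X) f - c\<bar> \<le> 1 + C"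
    and "measure_pmf.variance (pmf_of_set X) f \<le> C"
proof -
  define k where "k = real (card X)"
  have k: "0 < k" unfolding k_def using X by (simp add: card_gt_0_iff)
  have E: "measure_pmf.expectation (pmf_of_set X) g = (\<Sum>x\<in>X. g x) / k" for g :: "'a \<Rightarrow> real"
    unfolding k_def using X by (simp add: integral_pmf_of_set)
  define e where "e = (\<Sum>x\<in>X. f x) / k"
  have sum_f: "(\<Sum>x\<in>X. f x) = k * e" unfolding e_def using k by simp
  have var: "(\<Sum>x\<in>X. (f x - c)\<^sup>2) = (\<Sum>x\<in>X. (f x - e)\<^sup>2) + k * (e - c)\<^sup>2"
  proof -
    have "(\<Sum>x\<in>X. (f x - c)\<^sup>2) = (\<Sum>x\<in>X. (f x - e)\<^sup>2 + 2 * (e - c) * f x + (c\<^sup>2 - e\<^sup>2))"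
      by (intro sum.cong refl) (simp add: power2_eq_square algebra_simps)
    also have "\<dots> = (\<Sum>x\<in>X. (f x - e)\<^sup>2) + 2 * (e - c) * (k * e) + k * (c\<^sup>2 - e\<^sup>2)"
      unfolding sum.distrib sum_distrib_left[symmetric] sum_f by (simp add: k_def)
    also have "\<dots> = (\<Sum>x\<in>X. (f x - e)\<^sup>2) + k * (e - c)\<^sup>2" by (simp add: power2_eq_square algebra_simps)
    finally show ?thesis .
  qed
  have le: "(\<Sum>x\<in>X. (f x - e)\<^sup>2) / k + (e - c)\<^sup>2 \<le> C"
    using bound k unfolding var k_def[symmetric] by (simp add: add_divide_distrib)
  have "0 \<le> (\<Sum>x\<in>X. (f x - e)\<^sup>2) / k" using k by (intro divide_nonneg_pos sum_nonneg) auto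
  then have "(e - c)\<^sup>2 \<le> C" using le by linarith
  moreover have "\<bar>e - c\<bar> \<le> 1 + (e - c)\<^sup>2"
  proof -
    have "0 \<le> (\<bar>e - c\<bar> - 1)\<^sup>2" by simp
    then have "2 * \<bar>e - c\<bar> \<le> 1 + (e - c)\<^sup>2" by (simp add: power2_diff)
    moreover have "a \<le> 1 + s" if "2 * a \<le> 1 + s" "0 \<le> s" for a s :: real using that by linarith
    ultimately show ?thesis using zero_le_power2 by blast
  qed
  ultimately show "\<bar>measure_pmf.expectation (pmf_of_set X) f - c\<bar> \<le> 1 + C"
    unfolding E e_def[symmetric] by linarith
  have "0 \<le> (e - c)\<^sup>2" by simp
  then show "measure_pmf.variance (pmf_of_set X) f \<le> C"
    unfolding E e_def[symmetric] using le by linarith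
qed

theorem theorem3:
  fixes p :: nat
  assumes "prime p"
  shows "\<exists>K::real. \<forall>n\<ge>1. \<forall>H. sylow_subgroup p (sym_group (p ^ n)) H \<longrightarrow>
    (let P = (sym_group (p ^ n)) \<lparr>carrier := H\<rparr>;
         \<xi> = log_class_ord p P
     in \<bar>measure_pmf.expectation (random_conj_class P) \<xi> - ln (real n) / ln (real p)\<bar> \<le> K \<and>
        measure_pmf.variance (random_conj_class P) \<xi> \<le> K)"
proof -
  have p2: "p \<ge> 2" using prime_ge_2_nat[OF assms] .
  obtain C where C: "0 \<le> C" "\<And>n m X (f :: (nat \<Rightarrow> nat) set \<Rightarrow> nat). finite X \<Longrightarrow> X \<noteq> {} \<Longrightarrow>
    (\<And>i. real (card {x\<in>X. f x \<le> i}) = class_count p n i) \<Longrightarrow> p ^ m \<le> n \<Longrightarrow> n < p ^ Suc m \<Longrightarrow>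
    (\<Sum>x\<in>X. (real (f x) - real m)\<^sup>2) / real (card X) \<le> C"
    using second_moment_bounded[OF p2] by blast
  have "\<bar>measure_pmf.expectation (random_conj_class P) \<xi> - ln (real n) / ln (real p)\<bar> \<le> 2 + C \<and>
        measure_pmf.variance (random_conj_class P) \<xi> \<le> 2 + C"
    if n: "n \<ge> 1" and H: "sylow_subgroup p (sym_group (p ^ n)) H"
      and P: "P = (sym_group (p ^ n)) \<lparr>carrier := H\<rparr>" and \<xi>: "\<xi> = log_class_ord p P" for n H P \<xi>
  proof -
    obtain m where m: "p ^ m \<le> n" "n < p ^ Suc m" using ex_power_ivl1[OF p2 n] by auto
    have sub: "subgroup H (sym_group (p ^ n))" using H unfolding sylow_subgroup_def by simp
    interpret P: group P
      unfolding P using sub sym_group_is_group by (rule subgroup.subgroup_is_group)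
    have "finite (carrier P)"
      unfolding P using finite_subset[OF subgroup.subset[OF sub] finite_sym_group] by simp
    then have X: "finite (conj_classes P)" "conj_classes P \<noteq> {}"
      using finite_conj_classes P.conj_classes_nonempty by auto
    define f where "f C = multiplicity p (class_ord P C)" for C
    have "order P = p ^ multiplicity p (fact (p ^ n) :: nat)"
      using H unfolding P order_sym_subgroup sylow_subgroup_sym_group_iff by simp
    then have f: "class_ord P C = p ^ f C" if "C \<in> conj_classes P" for C
      unfolding f_def using P.class_ord_prime_power[OF assms _ that] by blast
    have "{C \<in> conj_classes P. f C \<le> i} = {C \<in> conj_classes P. class_ord P C dvd p ^ i}" for i
      using f p2 by (intro Collect_cong conj_cong refl) (simp add: dvd_power_iff_le)
    then have "real (card {C \<in> conj_classes P. f C \<le> i}) = class_count p n i" for i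
      using card_classes_sylow[OF assms H, of i] unfolding P by simp
    then have "(\<Sum>C\<in>conj_classes P. (real (f C) - real m)\<^sup>2) / real (card (conj_classes P)) \<le> C"
      using C(2)[OF X] m by blast
    moreover have "\<xi> C = real (f C)" if "C \<in> conj_classes P" for C
      unfolding \<xi> log_class_ord_def f[OF that] using p2 by (simp add: log_nat_power)
    ultimately have "(\<Sum>C\<in>conj_classes P. (\<xi> C - real m)\<^sup>2) / real (card (conj_classes P)) \<le> C" by simp
    note mv = mean_variance_from_second_moment[OF X this]
    show ?thesis
      using mv floor_log_close[OF p2 m] C(1) unfolding random_conj_class_def by linarith
  qed
  then show ?thesis unfolding Let_def by blast
qed

end
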